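(* Let $\mathcal{I}$ be an instance of Weighted $k$-Server on the uniform metric with $k_j$ servers of weight $W_j$ for all $j\in[\ell]$. There is a randomized (polynomial-time) online algorithm for $\mathcal{I}$ that uses at most $2\ell k_j$ servers of weight $W_j$ for each $j\in[\ell]$ and has expected server movement cost at most $O(\ell^2\log\ell)$ times the optimal cost of $\mathcal{I}$.
   Context: Weighted $k$-Server on the uniform metric: there is a set of $n$ points $V=\{1,\dots,n\}$ with $d(v,v')=1$ for all $v\neq v'$, and $k$ servers, server $i$ having weight $w_i\ge 0$; the distinct weights are $W_1,\dots,W_\ell$ with $k_j$ servers of weight $W_j$. A request sequence $\sigma_1,\dots,\sigma_T\in V$ is given; in the online setting the requests are revealed one at a time and, upon the arrival of $\sigma_t$, the algorithm must (irrevocably) move servers so that some server is at $\sigma_t$ before seeing future requests. Starting from given initial positions, the cost of a solution is $\frac12\sum_i w_i\cdot(\text{number of times server } i \text{ changes location})$. The optimal cost of $\mathcal{I}$ is the minimum cost of an offline solution (knowing the whole sequence) using exactly the given $k_j$ servers of each weight $W_j$. *)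

theory Defs
  imports
    "HOL-Probability.Probability_Mass_Function"
    "HOL-Library.Landau_Symbols"
    "HOL-Computational_Algebra.Polynomial"
begin

section \<open>Weighted k-server on the uniform metric\<close>

text \<open>
  An instance without its request sequence. Points are \<open>1, \<dots>, npts\<close>; weight classes are
  \<open>1, \<dots>, nclasses\<close>; class \<open>j\<close> consists of the servers \<open>(j, 1), \<dots>, (j, cnt j)\<close>, all of weight
  \<open>wt j\<close>; server \<open>(j, i)\<close> starts at the point \<open>start j i\<close>.
\<close>

record wks =
  npts :: nat
  nclasses :: nat
  cnt :: "nat \<Rightarrow> nat"
  wt :: "nat \<Rightarrow> real"
  start :: "nat \<Rightarrow> nat \<Rightarrow> nat"

definition points :: "wks \<Rightarrow> nat set" where
  "points I = {1..npts I}"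

definition wks_instance :: "wks \<Rightarrow> bool" where
  "wks_instance I \<longleftrightarrow>
     1 \<le> npts I \<and> 1 \<le> nclasses I \<and>
     (\<forall>j\<in>{1..nclasses I}. 1 \<le> cnt I j \<and> 0 \<le> wt I j) \<and>
     inj_on (wt I) {1..nclasses I} \<and>
     (\<forall>j\<in>{1..nclasses I}. \<forall>i\<in>{1..cnt I j}. start I j i \<in> points I)"

type_synonym config = "nat \<Rightarrow> nat \<Rightarrow> nat"

text \<open>
  In the following, \<open>\<kappa> j\<close> is the number of servers of weight \<open>wt I j\<close> that are available. It is
  \<open>cnt I j\<close> for the offline optimum and larger for an algorithm with resource augmentation.
\<close>

definition placed :: "wks \<Rightarrow> (nat \<Rightarrow> nat) \<Rightarrow> config \<Rightarrow> bool" where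
  "placed I \<kappa> c \<longleftrightarrow> (\<forall>j\<in>{1..nclasses I}. \<forall>i\<in>{1..\<kappa> j}. c j i \<in> points I)"

definition covers :: "wks \<Rightarrow> (nat \<Rightarrow> nat) \<Rightarrow> nat \<Rightarrow> config \<Rightarrow> bool" where
  "covers I \<kappa> r c \<longleftrightarrow> (\<exists>j\<in>{1..nclasses I}. \<exists>i\<in>{1..\<kappa> j}. c j i = r)"

text \<open>
  A schedule lists the configuration before the first request, followed by the configuration in
  which each request is served. The servers of the instance begin at their given positions; the
  position at which an additional server begins is not prescribed.
\<close>

definition schedule :: "wks \<Rightarrow> (nat \<Rightarrow> nat) \<Rightarrow> nat list \<Rightarrow> config list \<Rightarrow> bool" where
  "schedule I \<kappa> \<sigma> cs \<longleftrightarrow>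
     (\<exists>c0 ds. cs = c0 # ds \<and> placed I \<kappa> c0 \<and>
        (\<forall>j\<in>{1..nclasses I}. \<forall>i\<in>{1..cnt I j}. c0 j i = start I j i) \<and>
        list_all2 (\<lambda>r c. placed I \<kappa> c \<and> covers I \<kappa> r c) \<sigma> ds)"

definition move_cost :: "wks \<Rightarrow> (nat \<Rightarrow> nat) \<Rightarrow> config \<Rightarrow> config \<Rightarrow> real" where
  "move_cost I \<kappa> c c' =
     1 / 2 * (\<Sum>j = 1..nclasses I. \<Sum>i = 1..\<kappa> j. wt I j * (if c j i \<noteq> c' j i then 1 else 0))"

fun cost :: "wks \<Rightarrow> (nat \<Rightarrow> nat) \<Rightarrow> config list \<Rightarrow> real" where
  "cost I \<kappa> (c # c' # cs) = move_cost I \<kappa> c c' + cost I \<kappa> (c' # cs)"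
| "cost I \<kappa> _ = 0"

text \<open>
  The infimum is a minimum: the set of costs is nonempty for a valid instance with requests in
  \<open>points I\<close>, and finite.
\<close>

definition opt :: "wks \<Rightarrow> nat list \<Rightarrow> real" where
  "opt I \<sigma> = Inf {cost I (cnt I) cs | cs. schedule I (cnt I) \<sigma> cs}"


section \<open>Randomized polynomial-time computation\<close>

text \<open>
  Since weights are real numbers, running time is measured on a random access machine whose memory
  consists of named two-dimensional arrays of naturals and of reals, with indirect addressing and
  fair coin flips. Every instruction or test costs one step. The arithmetic is deliberately weak:
  naturals are only added and subtracted, reals are added, subtracted, compared, and multiplied or
  divided by naturals; the only constants are naturals. Hence on rational data the binary length
  of all numbers stays polynomial in the number of steps and in the length of the data, so that
  polynomial time in this model is not an artefact of unit-cost arithmetic.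
\<close>

record store =
  nats :: "string \<Rightarrow> nat \<Rightarrow> nat \<Rightarrow> nat"
  reals :: "string \<Rightarrow> nat \<Rightarrow> nat \<Rightarrow> real"

datatype nexp =
    NConst nat
  | NCell string nexp nexp
  | NAdd nexp nexp
  | NSub nexp nexp

datatype rexp =
    RNat nexp
  | RCell string nexp nexp
  | RAdd rexp rexp
  | RSub rexp rexp
  | RScale nexp rexp
  | RDiv rexp nexp

datatype bexp =
    NLess nexp nexp
  | RLess rexp rexp
  | BNot bexp
  | BAnd bexp bexp

datatype com =
    SKIP
  | NSet string nexp nexp nexp
  | RSet string nexp nexp rexp
  | Flip string
  | Seq com com
  | Cond bexp com com
  | While bexp com

primrec nval :: "store \<Rightarrow> nexp \<Rightarrow> nat" where
  "nval s (NConst m) = m"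
| "nval s (NCell x a b) = nats s x (nval s a) (nval s b)"
| "nval s (NAdd a b) = nval s a + nval s b"
| "nval s (NSub a b) = nval s a - nval s b"

primrec rval :: "store \<Rightarrow> rexp \<Rightarrow> real" where
  "rval s (RNat a) = real (nval s a)"
| "rval s (RCell x a b) = reals s x (nval s a) (nval s b)"
| "rval s (RAdd a b) = rval s a + rval s b"
| "rval s (RSub a b) = rval s a - rval s b"
| "rval s (RScale a b) = real (nval s a) * rval s b"
| "rval s (RDiv a b) = rval s a / real (nval s b)"

primrec bval :: "store \<Rightarrow> bexp \<Rightarrow> bool" where
  "bval s (NLess a b) \<longleftrightarrow> nval s a < nval s b"
| "bval s (RLess a b) \<longleftrightarrow> rval s a < rval s b"
| "bval s (BNot b) \<longleftrightarrow> \<not> bval s b"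
| "bval s (BAnd a b) \<longleftrightarrow> bval s a \<and> bval s b"

definition put_nat :: "string \<Rightarrow> nat \<Rightarrow> nat \<Rightarrow> nat \<Rightarrow> store \<Rightarrow> store" where
  "put_nat x i j v s = s\<lparr>nats := (nats s)(x := (nats s x)(i := (nats s x i)(j := v)))\<rparr>"

definition put_real :: "string \<Rightarrow> nat \<Rightarrow> nat \<Rightarrow> real \<Rightarrow> store \<Rightarrow> store" where
  "put_real x i j v s = s\<lparr>reals := (reals s)(x := (reals s x)(i := (reals s x i)(j := v)))\<rparr>"

text \<open>A command and a store form a machine state; the machine has halted iff the command is
  \<open>SKIP\<close>.\<close>

primrec step :: "com \<Rightarrow> store \<Rightarrow> (com \<times> store) pmf" where
  "step SKIP s = return_pmf (SKIP, s)"
| "step (NSet x a b e) s =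
     return_pmf (SKIP, put_nat x (nval s a) (nval s b) (nval s e) s)"
| "step (RSet x a b e) s =
     return_pmf (SKIP, put_real x (nval s a) (nval s b) (rval s e) s)"
| "step (Flip x) s =
     map_pmf (\<lambda>h. (SKIP, put_nat x 0 0 (if h then 1 else 0) s)) (bernoulli_pmf (1 / 2))"
| "step (Seq c d) s =
     (if c = SKIP then return_pmf (d, s)
      else map_pmf (\<lambda>(c', s'). (Seq c' d, s')) (step c s))"
| "step (Cond b c d) s = return_pmf (if bval s b then c else d, s)"
| "step (While b c) s = return_pmf (if bval s b then Seq c (While b c) else SKIP, s)"

primrec steps :: "nat \<Rightarrow> com \<times> store \<Rightarrow> (com \<times> store) pmf" where
  "steps 0 m = return_pmf m"
| "steps (Suc N) m = bind_pmf (step (fst m) (snd m)) (steps N)"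


section \<open>Online execution\<close>

text \<open>The number of points plus the number of servers.\<close>

definition inst_size :: "wks \<Rightarrow> nat" where
  "inst_size I = npts I + (\<Sum>j = 1..nclasses I. cnt I j)"

text \<open>The machine sees everything but the requests; its server positions are kept in \<open>pos\<close>, which
  initially holds the given positions.\<close>

definition load :: "wks \<Rightarrow> store" where
  "load I =
     \<lparr>nats = (\<lambda>_ _ _. 0)
        (''n'' := \<lambda>_ _. npts I,
         ''l'' := \<lambda>_ _. nclasses I,
         ''k'' := \<lambda>j _. if j \<in> {1..nclasses I} then cnt I j else 0,
         ''pos'' := \<lambda>j i. if j \<in> {1..nclasses I} \<and> i \<in> {1..cnt I j} then start I j i else 0),
      reals = (\<lambda>_ _ _. 0)
        (''W'' := \<lambda>j _. if j \<in> {1..nclasses I} then wt I j else 0)\<rparr>"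

definition config_of :: "com \<times> store \<Rightarrow> config" where
  "config_of m = nats (snd m) ''pos''"

text \<open>
  An online algorithm is a pair of programs. The first one runs once, before any request is known,
  and chooses the initial positions of the additional servers. The second one runs once per
  request, which it finds in \<open>req\<close>; later requests are not in memory, and the
  configuration is read off irrevocably when its time is over. The memory is kept between runs.

  The function \<open>B\<close> bounds the running time: the first program gets \<open>B 0\<close> steps, and the
  program serving the \<open>t\<close>-th request gets \<open>B t\<close> steps. Halted machines idle, so a
  smaller running time is harmless. The result is the random list of machine states at the end of
  these runs; it has finite support.
\<close>

type_synonym online_alg = "com \<times> com"

primrec serve :: "com \<Rightarrow> (nat \<Rightarrow> nat) \<Rightarrow> nat list \<Rightarrow> nat \<Rightarrow> store \<Rightarrow> (com \<times> store) list pmf" where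
  "serve c B [] t s = return_pmf []"
| "serve c B (r # \<sigma>) t s =
     bind_pmf (steps (B t) (c, put_nat ''req'' 0 0 r s))
       (\<lambda>m. map_pmf (Cons m) (serve c B \<sigma> (Suc t) (snd m)))"

definition play :: "online_alg \<Rightarrow> (nat \<Rightarrow> nat) \<Rightarrow> wks \<Rightarrow> nat list \<Rightarrow> (com \<times> store) list pmf" where
  "play A B I \<sigma> =
     bind_pmf (steps (B 0) (fst A, load I))
       (\<lambda>m. map_pmf (Cons m) (serve (snd A) B \<sigma> 1 (snd m)))"

definition all_halted :: "(com \<times> store) list \<Rightarrow> bool" where
  "all_halted ms \<longleftrightarrow> (\<forall>m\<in>set ms. fst m = SKIP)"

definition expected_cost ::
  "online_alg \<Rightarrow> (nat \<Rightarrow> nat) \<Rightarrow> wks \<Rightarrow> (nat \<Rightarrow> nat) \<Rightarrow> nat list \<Rightarrow> real" where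
  "expected_cost A B I \<kappa> \<sigma> =
     measure_pmf.expectation (play A B I \<sigma>) (\<lambda>ms. cost I \<kappa> (map config_of ms))"

end

theory Submission
  imports Defs
begin

text \<open>
  A deterministic algorithm suffices, and it is even \<open>4\<ell>\<close>-competitive. Every class \<open>j\<close> keeps a
  counter \<open>c j v \<le> wt j\<close> for each point. When a request \<open>r\<close> hits no server, all counters of \<open>r\<close>
  grow by the same amount \<open>\<theta>\<close>, the least one for which some class \<open>a\<close> reaches \<open>c a r = wt a\<close>; that
  counter is reset and the oldest server of class \<open>a\<close> moves to \<open>r\<close>. An offline server of class \<open>j\<close>
  standing on \<open>v\<close> owes \<open>wt j - c j v\<close> if \<open>v\<close> is not occupied by our class \<open>j\<close>, and otherwise the
  fraction of \<open>wt j\<close> given by the elapsed part of the time until \<open>v\<close> is evicted. A miss lowers the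
  total debt by \<open>\<theta>\<close>, since some offline server stands on \<open>r\<close>, while the insertion ages the at most
  \<open>k\<^sub>a\<close> offline points of class \<open>a\<close>, which with \<open>2\<ell>k\<^sub>a\<close> servers raises the debt by at most
  \<open>3/(4\<ell>) wt a\<close>. The counters change by \<open>\<ell>\<theta> - wt a\<close> in total, so twice the sum of
  \<open>\<ell>\<close> times the debt and all counters drops by \<open>wt a / 2\<close>, the cost of the insertion; an offline
  move raises it by at most \<open>4\<ell>\<close> times its cost.
\<close>

section \<open>Timed deterministic runs\<close>

lemma nats_put_nat [simp]:
  "nats (put_nat x i j v s) = (nats s)(x := (nats s x)(i := (nats s x i)(j := v)))"
  by (simp add: put_nat_def)

lemma reals_put_nat [simp]: "reals (put_nat x i j v s) = reals s"
  by (simp add: put_nat_def)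

lemma reals_put_real [simp]:
  "reals (put_real x i j v s) = (reals s)(x := (reals s x)(i := (reals s x i)(j := v)))"
  by (simp add: put_real_def)

lemma nats_put_real [simp]: "nats (put_real x i j v s) = nats s"
  by (simp add: put_real_def)

text \<open>Only machine steps whose outcome is a point mass are recorded, so programs can be
  verified without mentioning distributions. The condition \<open>c \<noteq> SKIP\<close> makes
  \<open>n\<close> count genuine steps and not the idling of a halted machine.\<close>

inductive reach :: "nat \<Rightarrow> com \<times> store \<Rightarrow> com \<times> store \<Rightarrow> bool" where
  reach_refl: "reach 0 m m"
| reach_step: "c \<noteq> SKIP \<Longrightarrow> step c s = return_pmf m' \<Longrightarrow> reach n m' m'' \<Longrightarrow> reach (Suc n) (c, s) m''"

lemma reach_trans: "reach n m m' \<Longrightarrow> reach n' m' m'' \<Longrightarrow> reach (n + n') m m''"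
  by (induction rule: reach.induct) (auto intro: reach.intros)

lemma reach_Seq: "reach n m m' \<Longrightarrow> reach n (Seq (fst m) d, snd m) (Seq (fst m') d, snd m')"
proof (induction rule: reach.induct)
  case (reach_step c s m' n m'')
  then have "step (Seq c d) s = return_pmf (Seq (fst m') d, snd m')"
    by (cases m') simp
  with reach_step.IH show ?case
    by (auto intro: reach.reach_step)
qed (auto intro: reach_refl)

lemma steps_SKIP: "steps N (SKIP, s) = return_pmf (SKIP, s)"
  by (induction N) (simp_all add: bind_return_pmf)

text \<open>A halted machine idles, so any budget \<open>N \<ge> n\<close> ends in the same point
  mass.\<close>

lemma steps_if_reach: "reach n m m' \<Longrightarrow> fst m' = SKIP \<Longrightarrow> n \<le> N \<Longrightarrow> steps N m = return_pmf m'"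
proof (induction arbitrary: N rule: reach.induct)
  case (reach_refl m)
  then show ?case by (cases m) (simp add: steps_SKIP)
next
  case (reach_step c s m' n m'')
  from \<open>Suc n \<le> N\<close> obtain N' where "N = Suc N'" "n \<le> N'"
    by (cases N) auto
  with reach_step show ?case by (simp add: bind_return_pmf)
qed

text \<open>Total correctness with a step bound. The postcondition is a predicate on the final
  store, as in weakest preconditions, so the rules for compound commands nest.\<close>

definition runs :: "com \<Rightarrow> nat \<Rightarrow> store \<Rightarrow> (store \<Rightarrow> bool) \<Rightarrow> bool" where
  "runs c T s Q \<longleftrightarrow> (\<exists>n\<le>T. \<exists>s'. reach n (c, s) (SKIP, s') \<and> Q s')"

lemma runs_weaken:
  "runs c T s Q \<Longrightarrow> T \<le> T' \<Longrightarrow> (\<And>s'. Q s' \<Longrightarrow> Q' s') \<Longrightarrow> runs c T' s Q'"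
  unfolding runs_def by (meson le_trans)

lemma runs_SKIP: "Q s \<Longrightarrow> runs SKIP 0 s Q"
  unfolding runs_def by (auto intro: reach_refl)

lemma runs_NSet: "Q (put_nat x (nval s a) (nval s b) (nval s e) s) \<Longrightarrow> runs (NSet x a b e) 1 s Q"
  unfolding runs_def by (intro exI[of _ 1]) (auto intro!: reach_refl reach_step)

lemma runs_RSet: "Q (put_real x (nval s a) (nval s b) (rval s e) s) \<Longrightarrow> runs (RSet x a b e) 1 s Q"
  unfolding runs_def by (intro exI[of _ 1]) (auto intro!: reach_refl reach_step)

text \<open>The additional step is the one that discards the finished first command.\<close>

lemma runs_Seq:
  assumes "runs c T1 s (\<lambda>s'. runs d T2 s' Q)"
  shows "runs (Seq c d) (T1 + (T2 + 1)) s Q"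
proof -
  from assms obtain n1 s1 n2 s2 where
    r: "n1 \<le> T1" "reach n1 (c, s) (SKIP, s1)" "n2 \<le> T2" "reach n2 (d, s1) (SKIP, s2)" "Q s2"
    unfolding runs_def by blast
  have "reach n1 (Seq c d, s) (Seq SKIP d, s1)"
    using reach_Seq[OF r(2)] by simp
  moreover have "reach (Suc n2) (Seq SKIP d, s1) (SKIP, s2)"
    using r(4) by (auto intro: reach_step)
  ultimately have "reach (n1 + Suc n2) (Seq c d, s) (SKIP, s2)"
    by (rule reach_trans)
  with r show ?thesis
    unfolding runs_def by (intro exI[of _ "n1 + Suc n2"]) auto
qed

lemma runs_Cond:
  assumes "bval s b \<Longrightarrow> runs c T s Q" and "\<not> bval s b \<Longrightarrow> runs d T' s Q"
  shows "runs (Cond b c d) (T + T' + 1) s Q"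
proof -
  have "\<exists>n\<le>T + T'. \<exists>s'. reach n (if bval s b then c else d, s) (SKIP, s') \<and> Q s'"
    using assms unfolding runs_def by (auto intro: trans_le_add1 trans_le_add2)
  then obtain n s' where n: "n \<le> T + T'" "Q s'"
    and "reach n (if bval s b then c else d, s) (SKIP, s')" by blast
  then have "reach (Suc n) (Cond b c d, s) (SKIP, s')"
    by (auto intro: reach_step)
  with n show ?thesis unfolding runs_def by (intro exI[of _ "Suc n"]) auto
qed

text \<open>The invariant is indexed by the number of completed iterations, of which there are
  exactly \<open>M\<close>. Each costs the \<open>T\<close> steps of the body, one step for the test
  and one for discarding the finished body; the final step is the failing test.\<close>

lemma runs_While:
  assumes "Inv 0 s"
    and body: "\<And>m s. m < M \<Longrightarrow> Inv m s \<Longrightarrow> bval s b \<and> runs c T s (Inv (Suc m))"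
    and exit: "\<And>s. Inv M s \<Longrightarrow> \<not> bval s b \<and> Q s"
  shows "runs (While b c) (M * (T + 2) + 1) s Q"
proof -
  have "runs (While b c) ((M - m) * (T + 2) + 1) s Q" if "m \<le> M" "Inv m s" for m s
    using that
  proof (induction "M - m" arbitrary: m s)
    case 0
    then have "m = M" by simp
    with 0 exit have "\<not> bval s b" "Q s" by auto
    then have "reach 1 (While b c, s) (SKIP, s)"
      by (auto intro!: reach_step reach_refl)
    with \<open>Q s\<close> \<open>m = M\<close> show ?case unfolding runs_def by auto
  next
    case (Suc d)
    then have m: "m < M" "d = M - Suc m" by auto
    with body Suc.prems have b: "bval s b" and r: "runs c T s (Inv (Suc m))" by blast+
    from r have "runs c T s (\<lambda>s'. runs (While b c) (d * (T + 2) + 1) s' Q)"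
      using Suc.hyps(1)[OF m(2)] m by (auto elim!: runs_weaken)
    from runs_Seq[OF this] obtain n s' where
      n: "n \<le> T + (d * (T + 2) + 1 + 1)" "reach n (Seq c (While b c), s) (SKIP, s')" "Q s'"
      unfolding runs_def by blast
    have "reach (Suc n) (While b c, s) (SKIP, s')"
      using n b by (auto intro: reach_step)
    moreover have "Suc n \<le> (M - m) * (T + 2) + 1"
      using n(1) by (simp flip: Suc.hyps(2))
    ultimately show ?case using n(3) unfolding runs_def by blast
  qed
  from this[of 0 s] assms(1) show ?thesis by simp
qed

lemma steps_if_runs:
  assumes "runs c T s Q" "T \<le> N"
  obtains s' where "steps N (c, s) = return_pmf (SKIP, s')" "Q s'"
proof -
  from assms obtain n s' where "n \<le> N" "reach n (c, s) (SKIP, s')" "Q s'"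
    unfolding runs_def by (meson le_trans)
  with steps_if_reach that show thesis by fastforce
qed


section \<open>Insertions into one weight class\<close>

text \<open>
  A weight class is a queue of slots \<open>1, \<dots>, K\<close> that are overwritten cyclically, slot \<open>p\<close> being the
  next one; slot \<open>s\<close> is overwritten by the \<open>remaining K p s\<close>-th insertion from now on. A
  lifetime \<open>L s = 0\<close> marks a slot that still holds an arbitrary initial point: division by zero then
  makes it contribute nothing to \<open>safety\<close>.
\<close>

definition remaining :: "nat \<Rightarrow> nat \<Rightarrow> nat \<Rightarrow> nat" where
  "remaining K p s = (if p \<le> s then s - p + 1 else K + s - p + 1)"

definition advance :: "nat \<Rightarrow> nat \<Rightarrow> nat" where
  "advance K p = (if p < K then p + 1 else 1)"

text \<open>This is the part of \<open>w\<close> that an offline server on \<open>v\<close> does not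
  owe. The maximum allows \<open>v\<close> to be held by several slots at once, and including
  \<open>c v\<close> makes the counter a lower bound even for an occupied point.\<close>

definition safety ::
  "real \<Rightarrow> nat \<Rightarrow> nat \<Rightarrow> (nat \<Rightarrow> nat) \<Rightarrow> (nat \<Rightarrow> nat) \<Rightarrow> (nat \<Rightarrow> real) \<Rightarrow> nat \<Rightarrow> real" where
  "safety w K p L x c v =
     Max (insert (c v) ((\<lambda>s. w * remaining K p s / L s) ` {s \<in> {1..K}. x s = v}))"

text \<open>With truncated subtraction, the second bound reads \<open>K \<le> L s\<close> for
  \<open>s > k\<close> and \<open>K - k + s \<le> L s\<close> for \<open>s \<le> k\<close>, the
  latter allowing for the shorter lives of initial occupants.\<close>

definition lifetimes :: "nat \<Rightarrow> nat \<Rightarrow> nat \<Rightarrow> (nat \<Rightarrow> nat) \<Rightarrow> bool" where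
  "lifetimes k K p L \<longleftrightarrow> (\<forall>s\<in>{1..K}. L s = 0 \<or> remaining K p s \<le> L s \<and> K \<le> L s + (k - s))"

section \<open>Ageing of the slots and bounds on safety\<close>

lemma remaining_advance:
  "p \<in> {1..K} \<Longrightarrow> s \<in> {1..K} \<Longrightarrow> s \<noteq> p \<Longrightarrow> remaining K p s = Suc (remaining K (advance K p) s)"
  by (auto simp: remaining_def advance_def)

lemma remaining_advance_same: "p \<in> {1..K} \<Longrightarrow> remaining K (advance K p) p = K"
  by (auto simp: remaining_def advance_def)

lemma remaining_same: "remaining K p p = 1"
  by (simp add: remaining_def)

lemma lifetimes_advance:
  assumes "lifetimes k K p L" "p \<in> {1..K}"
  shows "lifetimes k K (advance K p) (L(p := K))"
  unfolding lifetimes_def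
proof
  fix s assume "s \<in> {1..K}"
  with assms show "(L(p := K)) s = 0 \<or>
      remaining K (advance K p) s \<le> (L(p := K)) s \<and> K \<le> (L(p := K)) s + (k - s)"
    using remaining_advance[of p K s] remaining_advance_same[of p K]
    unfolding lifetimes_def by (cases "s = p") force+
qed

lemma safety_ge: "c v \<le> safety w K p L x c v"
  unfolding safety_def by (rule Max_ge) auto

lemma safety_ge_slot:
  fixes w :: real
  shows "s \<in> {1..K} \<Longrightarrow> x s = v \<Longrightarrow> w * remaining K p s / L s \<le> safety w K p L x c v"
  unfolding safety_def by (rule Max_ge) auto

lemma safety_absent: "(\<And>s. s \<in> {1..K} \<Longrightarrow> x s \<noteq> v) \<Longrightarrow> safety w K p L x c v = c v"
  unfolding safety_def by (simp add: Collect_empty_eq[THEN iffD2])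

lemma safety_cases:
  fixes w :: real
  obtains "safety w K p L x c v = c v"
  | s where "s \<in> {1..K}" "x s = v" "safety w K p L x c v = w * remaining K p s / L s"
proof -
  have "safety w K p L x c v \<in> insert (c v) ((\<lambda>s. w * remaining K p s / L s) ` {s \<in> {1..K}. x s = v})"
    unfolding safety_def by (rule Max_in) auto
  then show thesis using that by auto
qed

lemma safety_le:
  fixes w :: real
  assumes "lifetimes k K p L" "0 \<le> w" "c v \<le> w"
  shows "safety w K p L x c v \<le> w"
proof (cases rule: safety_cases[of w K p L x c v])
  case (2 s)
  \<comment> \<open>For \<open>L s = 0\<close> the quotient is 0.\<close>
  have "real (remaining K p s) / L s \<le> 1"
    using assms(1)[unfolded lifetimes_def, rule_format, OF 2(1)] by (auto simp: divide_le_eq)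
  then show ?thesis
    using 2(3) assms(2) mult_left_mono[of "real (remaining K p s) / L s" 1 w] by simp
qed (use assms in simp)

text \<open>The slot just filled has all \<open>K\<close> insertions of its lifetime left, so its
  fraction is 1.\<close>

lemma safety_insert_same:
  fixes w :: real
  assumes "p \<in> {1..K}"
  shows "w \<le> safety w K (advance K p) (L(p := K)) (x(p := v)) c v"
  using safety_ge_slot[of p K "x(p := v)" v w "advance K p" "L(p := K)" c]
    remaining_advance_same[OF assms] assms by auto

text \<open>An insertion brings every slot one step closer to eviction, which costs it
  \<open>w / L s\<close>. The witness is a slot attaining the old maximum; a maximum attained by the
  counter cannot drop.\<close>

lemma safety_insert_other:
  fixes w :: real
  assumes p: "p \<in> {1..K}" and w: "0 \<le> w" and uv: "u \<noteq> v" and c: "0 \<le> c u" "c' u = c u"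
    and lt: "safety w K (advance K p) (L(p := K)) (x(p := v)) c' u < safety w K p L x c u"
  obtains s where "s \<in> {1..K}" "x s = u"
    "safety w K p L x c u \<le> safety w K (advance K p) (L(p := K)) (x(p := v)) c' u + w / L s"
proof (cases rule: safety_cases[of w K p L x c u])
  case 1
  then show thesis
    using lt c safety_ge[of c' u w K "advance K p" "L(p := K)" "x(p := v)"] by simp
next
  case (2 s)
  let ?new = "safety w K (advance K p) (L(p := K)) (x(p := v)) c' u"
  have "w * remaining K p s / L s \<le> ?new + w / L s"
  proof (cases "s = p")
    \<comment> \<open>The evicted slot had one insertion left, so its old value was just
      \<open>w / L s\<close>; the new safety is at least the nonnegative counter.\<close>
    case True
    then show ?thesis
      using c safety_ge[of c' u w K "advance K p" "L(p := K)" "x(p := v)"]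
      by (simp add: remaining_same)
  next
    case False
    then have "w * remaining K (advance K p) s / L s \<le> ?new"
      using safety_ge_slot[of s K "x(p := v)" u w "advance K p" "L(p := K)" c'] 2 by simp
    then show ?thesis
      using remaining_advance[OF p 2(1) False] by (simp add: algebra_simps add_divide_distrib)
  qed
  with 2 that show thesis by simp
qed

text \<open>
  Slots that are filled by the algorithm live for \<open>K\<close> insertions, but the initial occupant of slot
  \<open>s \<le> k\<close> only lives for \<open>K - k + s\<close>. These staggered lifetimes keep the sum below \<open>1 / l\<close> by a
  constant factor even for \<open>l = 1\<close>.
\<close>

lemma sum_inverse_lifetimes:
  assumes L: "lifetimes k K p L" and K: "K = 2 * l * k" and lk: "1 \<le> l" "1 \<le> k"
    and A: "A \<subseteq> {1..K}" "card A \<le> k"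
  shows "(\<Sum>s\<in>A. 1 / real (L s)) \<le> 3 / (4 * real l)"
proof -
  have finA: "finite A" using A finite_subset by blast
  have kK: "real K - real k = (2 * real l - 1) * real k" by (simp add: K algebra_simps)
  have pos: "0 < real k" "0 < real K" "0 < real K - real k"
    unfolding kK using lk by (auto simp: K)
  \<comment> \<open>The bound splits into the share \<open>1 / K\<close> of a full lifetime and a
    surplus that vanishes for \<open>s \<ge> k\<close>.\<close>
  have each: "1 / real (L s) \<le> 1 / K + real (k - s) / (K * (real K - k))" if "s \<in> A" for s
  proof (cases "L s = 0")
    case False
    then have ge: "real K - real (k - s) \<le> L s"
      using L A that unfolding lifetimes_def by force
    have gap: "real K - real k \<le> real K - real (k - s)" by simp
    have "1 / real (L s) \<le> 1 / (real K - real (k - s))"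
      using ge gap pos by (intro divide_left_mono mult_pos_pos) auto
    also have "\<dots> = 1 / K + real (k - s) / (K * (real K - real (k - s)))"
      using pos gap by (simp add: field_simps)
    also have "\<dots> \<le> 1 / K + real (k - s) / (K * (real K - k))"
      using pos gap by (intro add_left_mono divide_left_mono mult_left_mono mult_pos_pos) auto
    finally show ?thesis .
  qed (use pos in auto)
  \<comment> \<open>The surpluses of all initial occupants together form a triangular sum, whichever
    slots \<open>A\<close> contains.\<close>
  have "(\<Sum>s\<in>A. real (k - s)) = (\<Sum>s\<in>A \<inter> {1..k}. real (k - s))"
    using A finA by (intro sum.mono_neutral_right) auto
  also have "\<dots> \<le> (\<Sum>s\<in>{1..k}. real (k - s))" by (intro sum_mono2) auto
  also have "\<dots> = (\<Sum>s\<in>{1..k}. real k - real s)" by (intro sum.cong) auto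
  also have "\<dots> = real k * real k - real k * (real k + 1) / 2"
    using double_gauss_sum_from_Suc_0[of k, where ?'a = real] by (simp add: sum_subtractf)
  also have "\<dots> \<le> real k * real k / 2" by (simp add: field_simps)
  finally have tri: "(\<Sum>s\<in>A. real (k - s)) \<le> real k * real k / 2" .
  have "(\<Sum>s\<in>A. 1 / real (L s)) \<le> (\<Sum>s\<in>A. 1 / K + real (k - s) / (K * (real K - k)))"
    by (intro sum_mono each)
  also have "\<dots> = card A / K + (\<Sum>s\<in>A. real (k - s)) / (K * (real K - k))"
    by (simp add: sum.distrib sum_divide_distrib)
  also have "\<dots> \<le> real k / K + (real k * real k / 2) / (K * (real K - k))"
    using A(2) tri pos by (intro add_mono divide_right_mono) auto
  \<comment> \<open>Here \<open>K = 2 * l * k\<close> and \<open>K - k = (2 * l - 1) * k\<close> are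
    inserted and all powers of \<open>k\<close> cancel.\<close>
  also have "\<dots> = 1 / (2 * real l) + 1 / (4 * real l * (2 * real l - 1))"
    unfolding kK using pos lk by (simp add: K)
  also have "\<dots> \<le> 1 / (2 * real l) + 1 / (4 * real l)"
    using lk by (intro add_left_mono divide_left_mono) auto
  also have "\<dots> = 3 / (4 * real l)" by (simp add: field_simps)
  finally show ?thesis .
qed

text \<open>Each point whose safety drops is charged to one slot that holds it. Distinct points lie
  in distinct slots, so at most \<open>k\<close> slots are charged and
  \<open>sum_inverse_lifetimes\<close> bounds the total.\<close>

lemma sum_safety_insert:
  fixes w :: real
  assumes L: "lifetimes k K p L" and K: "K = 2 * l * k" and lk: "1 \<le> l" "1 \<le> k"
    and p: "p \<in> {1..K}" and w: "0 \<le> w" and S: "finite S" "card S \<le> k"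
    and c: "\<And>u. 0 \<le> c u" "\<And>u. u \<noteq> v \<Longrightarrow> c' u = c u"
  shows "(\<Sum>u\<in>S - {v}. safety w K p L x c u
           - safety w K (advance K p) (L(p := K)) (x(p := v)) c' u) \<le> 3 / (4 * real l) * w"
    (is "(\<Sum>u\<in>_. ?old u - ?new u) \<le> _")
proof -
  define D where "D = {u \<in> S - {v}. ?new u < ?old u}"
  have "\<exists>s. s \<in> {1..K} \<and> x s = u \<and> ?old u \<le> ?new u + w / L s" if "u \<in> D" for u
    using that safety_insert_other[of p K w u v c c' L x] p w c unfolding D_def by blast
  then obtain g where g: "\<And>u. u \<in> D \<Longrightarrow> g u \<in> {1..K} \<and> x (g u) = u \<and> ?old u \<le> ?new u + w / L (g u)"
    by metis
  \<comment> \<open>The slot contents \<open>x\<close> invert the choice of slots.\<close>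
  have inj: "inj_on g D" by (rule inj_on_inverseI[of _ x]) (use g in auto)
  have DS: "D \<subseteq> S" unfolding D_def by auto
  have "(\<Sum>u\<in>S - {v}. ?old u - ?new u) \<le> (\<Sum>u\<in>S - {v}. if u \<in> D then ?old u - ?new u else 0)"
    by (intro sum_mono) (auto simp: D_def)
  also have "\<dots> = (\<Sum>u\<in>D. ?old u - ?new u)"
    using S by (intro sum.mono_neutral_cong_right) (auto simp: D_def)
  also have "\<dots> \<le> (\<Sum>u\<in>D. w / L (g u))"
    by (intro sum_mono) (use g in force)
  also have "\<dots> = w * (\<Sum>s\<in>g ` D. 1 / L s)"
    using inj by (simp add: sum.reindex sum_distrib_left)
  also have "\<dots> \<le> w * (3 / (4 * real l))"
    using g S DS card_image_le[of D g] card_mono[OF S(1) DS] finite_subset[OF DS S(1)]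
    by (intro mult_left_mono w sum_inverse_lifetimes[OF L K lk]) auto
  finally show ?thesis by (simp add: mult.commute)
qed


section \<open>The potential\<close>

definition aug :: "wks \<Rightarrow> nat \<Rightarrow> nat" where
  "aug I j = 2 * nclasses I * cnt I j"

text \<open>The invariant between requests. \<open>x\<close>, \<open>p\<close> and \<open>c\<close>
  are read off the memory of the machine, whereas the lifetimes \<open>L\<close> exist only in the
  analysis.\<close>

definition consistent ::
  "wks \<Rightarrow> config \<Rightarrow> (nat \<Rightarrow> nat) \<Rightarrow> (nat \<Rightarrow> nat \<Rightarrow> real) \<Rightarrow> (nat \<Rightarrow> nat \<Rightarrow> nat) \<Rightarrow> bool" where
  "consistent I x p c L \<longleftrightarrow> placed I (aug I) x \<and>
     (\<forall>j\<in>{1..nclasses I}. p j \<in> {1..aug I j} \<and> lifetimes (cnt I j) (aug I j) (p j) (L j) \<and>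
        (\<forall>v. 0 \<le> c j v \<and> c j v \<le> wt I j))"

definition debt ::
  "wks \<Rightarrow> config \<Rightarrow> (nat \<Rightarrow> nat) \<Rightarrow> (nat \<Rightarrow> nat \<Rightarrow> real) \<Rightarrow> (nat \<Rightarrow> nat \<Rightarrow> nat) \<Rightarrow> nat \<Rightarrow> nat \<Rightarrow> real" where
  "debt I x p c L j v = wt I j - safety (wt I j) (aug I j) (p j) (L j) (x j) (c j) v"

text \<open>Offline positions enter as an image, so a point shared by several servers of a class is
  counted once. This fits \<open>sum_safety_insert\<close>, where distinct points are charged to
  distinct slots.\<close>

definition potential ::
  "wks \<Rightarrow> config \<Rightarrow> (nat \<Rightarrow> nat) \<Rightarrow> (nat \<Rightarrow> nat \<Rightarrow> real) \<Rightarrow> (nat \<Rightarrow> nat \<Rightarrow> nat) \<Rightarrow> config \<Rightarrow> real" where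
  "potential I x p c L y =
     2 * real (nclasses I) * (\<Sum>j = 1..nclasses I. \<Sum>v\<in>y j ` {1..cnt I j}. debt I x p c L j v)
     + 2 * (\<Sum>j = 1..nclasses I. \<Sum>v\<in>points I. c j v)"

text \<open>The least slack \<open>wt I a - c a r\<close> is the growth \<theta> of the counters of
  \<open>r\<close>. Being a relation, this leaves the choice between classes of equal slack to the
  program.\<close>

definition inserts ::
  "wks \<Rightarrow> nat \<Rightarrow> nat \<Rightarrow> config \<Rightarrow> (nat \<Rightarrow> nat) \<Rightarrow> (nat \<Rightarrow> nat \<Rightarrow> real) \<Rightarrow>
     config \<Rightarrow> (nat \<Rightarrow> nat) \<Rightarrow> (nat \<Rightarrow> nat \<Rightarrow> real) \<Rightarrow> bool" where
  "inserts I r a x p c x' p' c' \<longleftrightarrow> a \<in> {1..nclasses I} \<and>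
     (\<forall>j\<in>{1..nclasses I}. wt I a - c a r \<le> wt I j - c j r) \<and>
     x' = x(a := (x a)(p a := r)) \<and>
     p' = p(a := advance (aug I a) (p a)) \<and>
     (\<forall>j\<in>{1..nclasses I}. c' j = (c j)(r := if j = a then 0 else c j r + (wt I a - c a r)))"

definition serves ::
  "wks \<Rightarrow> nat \<Rightarrow> config \<Rightarrow> (nat \<Rightarrow> nat) \<Rightarrow> (nat \<Rightarrow> nat \<Rightarrow> real) \<Rightarrow>
     config \<Rightarrow> (nat \<Rightarrow> nat) \<Rightarrow> (nat \<Rightarrow> nat \<Rightarrow> real) \<Rightarrow> bool" where
  "serves I r x p c x' p' c' \<longleftrightarrow>
     (if covers I (aug I) r x then x' = x \<and> p' = p \<and> c' = c
      else \<exists>a. inserts I r a x p c x' p' c')"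

section \<open>Bounds on the debt and changes of the potential\<close>

lemma instance_class:
  assumes "wks_instance I" "j \<in> {1..nclasses I}"
  shows "1 \<le> nclasses I" "1 \<le> cnt I j" "0 \<le> wt I j" "2 * cnt I j \<le> aug I j"
  using assms unfolding wks_instance_def aug_def by auto

lemma debt_bounds:
  assumes "wks_instance I" "consistent I x p c L" "j \<in> {1..nclasses I}"
  shows "0 \<le> debt I x p c L j v" "debt I x p c L j v \<le> wt I j"
proof -
  have c: "lifetimes (cnt I j) (aug I j) (p j) (L j)" "0 \<le> c j v" "c j v \<le> wt I j"
    using assms unfolding consistent_def by auto
  show "0 \<le> debt I x p c L j v"
    unfolding debt_def using safety_le[of "cnt I j" "aug I j" "p j" "L j" "wt I j" "c j" v "x j"]
      c(1,3) instance_class(3)[OF assms(1,3)] by simp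
  show "debt I x p c L j v \<le> wt I j"
    unfolding debt_def using c(2) safety_ge[of "c j" v "wt I j" "aug I j" "p j" "L j" "x j"] by simp
qed

lemma potential_nonneg:
  assumes "wks_instance I" "consistent I x p c L"
  shows "0 \<le> potential I x p c L y"
  unfolding potential_def using assms debt_bounds(1)[OF assms]
  by (intro add_nonneg_nonneg mult_nonneg_nonneg sum_nonneg) (auto simp: consistent_def)

text \<open>Leaving a point never adds debt, and entering one adds at most the weight of the moving
  server. The counters do not depend on the offline configuration.\<close>

lemma potential_opt_move:
  assumes "wks_instance I" "consistent I x p c L"
  shows "potential I x p c L y' \<le> potential I x p c L y + 4 * real (nclasses I) * move_cost I (cnt I) y y'"
proof -
  have "(\<Sum>v\<in>y' j ` {1..cnt I j}. debt I x p c L j v) \<le> (\<Sum>v\<in>y j ` {1..cnt I j}. debt I x p c L j v)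
      + (\<Sum>i = 1..cnt I j. wt I j * (if y j i \<noteq> y' j i then 1 else 0))"
    (is "sum ?d ?S' \<le> sum ?d ?S + ?m") if j: "j \<in> {1..nclasses I}" for j
  proof -
    note d = debt_bounds[OF assms j]
    let ?M = "{i \<in> {1..cnt I j}. y j i \<noteq> y' j i}"
    \<comment> \<open>Only servers that change location can contribute a new point to the
      image.\<close>
    have "sum ?d ?S' \<le> sum ?d (?S \<union> y' j ` ?M)"
      using d(1) by (intro sum_mono2) force+
    also have "\<dots> \<le> sum ?d ?S + sum ?d (y' j ` ?M)"
      using d(1) by (subst sum_Un) (auto intro!: sum_nonneg)
    also have "sum ?d (y' j ` ?M) \<le> (\<Sum>i\<in>?M. ?d (y' j i))"
      using d(1) sum_image_le[of ?M ?d "y' j"] by (simp add: o_def)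
    also have "\<dots> \<le> (\<Sum>i\<in>?M. wt I j)"
      using d(2) by (intro sum_mono) auto
    also have "\<dots> = ?m"
      by (intro sum.mono_neutral_cong_left) auto
    finally show ?thesis by simp
  qed
  from sum_mono[of "{1..nclasses I}", OF this]
  \<comment> \<open>The factor 2 undoes the one half in \<open>move_cost\<close>; with the
    coefficient \<open>2 * nclasses I\<close> of the debt this yields the factor 4.\<close>
  have "(\<Sum>j = 1..nclasses I. \<Sum>v\<in>y' j ` {1..cnt I j}. debt I x p c L j v)
      \<le> (\<Sum>j = 1..nclasses I. \<Sum>v\<in>y j ` {1..cnt I j}. debt I x p c L j v) + 2 * move_cost I (cnt I) y y'"
    by (simp add: sum.distrib move_cost_def)
  from mult_left_mono[OF this, of "2 * real (nclasses I)"] show ?thesis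
    unfolding potential_def by (simp add: algebra_simps)
qed

text \<open>Off \<open>r\<close>, only class \<open>a\<close> ages, which is bounded by
  \<open>sum_safety_insert\<close>. At \<open>r\<close> the debt falls by at least \<theta> in every
  class: in class \<open>a\<close> it was \<theta> and is cleared, elsewhere the counter grows by
  \<theta>.\<close>

lemma sum_debt_inserts:
  assumes I: "wks_instance I" and con: "consistent I x p c L"
    and unc: "\<not> covers I (aug I) r x" and ins: "inserts I r a x p c x' p' c'"
    and j: "j \<in> {1..nclasses I}" and S: "finite S" "card S \<le> cnt I j"
  shows "(\<Sum>v\<in>S. debt I x' p' c' (L(a := (L a)(p a := aug I a))) j v) \<le> (\<Sum>v\<in>S. debt I x p c L j v)
    + (if j = a then 3 / (4 * real (nclasses I)) * wt I a else 0) - (if r \<in> S then wt I a - c a r else 0)"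
    (is "(\<Sum>v\<in>S. ?d' v) \<le> (\<Sum>v\<in>S. ?d v) + ?inc - _")
proof -
  \<comment> \<open>On a miss no slot holds \<open>r\<close>, so its safety is exactly the
    counter.\<close>
  have absent: "safety (wt I j) (aug I j) (p j) (L j) (x j) (c j) r = c j r"
    using unc j by (intro safety_absent) (auto simp: covers_def)
  have split: "sum h S = sum h (S - {r}) + (if r \<in> S then h r else 0)" for h :: "nat \<Rightarrow> real"
    using S(1) by (auto simp: sum.remove)
  have pj: "p j \<in> {1..aug I j}" and lj: "lifetimes (cnt I j) (aug I j) (p j) (L j)"
    and cj: "\<And>v. 0 \<le> c j v"
    using con j unfolding consistent_def by auto
  have c': "c' j = (c j)(r := if j = a then 0 else c j r + (wt I a - c a r))"
    using ins j unfolding inserts_def by blast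
  have "(\<Sum>v\<in>S - {r}. ?d' v - ?d v) \<le> ?inc"
  proof (cases "j = a")
    case True
    have "x' a = (x a)(p a := r)" "p' a = advance (aug I a) (p a)"
      using ins unfolding inserts_def by auto
    then show ?thesis
      using sum_safety_insert[OF lj aug_def instance_class(1,2)[OF I j] pj instance_class(3)[OF I j] S
          cj, where v = r and c' = "c' j" and x = "x j"] c'
      by (simp add: True debt_def)
  next
    case False
    have "?d' v = ?d v" if "v \<noteq> r" for v
      using ins False that c' unfolding inserts_def by (auto simp: debt_def safety_def)
    then show ?thesis using False by (simp add: sum.neutral)
  qed
  moreover have "?d' r \<le> ?d r - (wt I a - c a r)"
  proof (cases "j = a")
    case True
    have "x' a = (x a)(p a := r)" "p' a = advance (aug I a) (p a)"
      using ins unfolding inserts_def by auto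
    then show ?thesis
      using safety_insert_same[OF pj, of "wt I j" "L j" "x j" r "c' j"] absent
      by (simp add: True debt_def)
  next
    case False
    then show ?thesis
      using ins absent c' safety_ge[of "c' j" r "wt I j" "aug I j" "p j" "L j" "x j"]
      unfolding inserts_def by (auto simp: debt_def)
  qed
  ultimately show ?thesis
    unfolding split[of ?d'] split[of ?d] by (auto simp: sum_subtractf)
qed

lemma consistent_inserts:
  assumes I: "wks_instance I" and con: "consistent I x p c L" and ins: "inserts I r a x p c x' p' c'"
    and r: "r \<in> points I"
  shows "consistent I x' p' c' (L(a := (L a)(p a := aug I a)))"
proof -
  have a: "a \<in> {1..nclasses I}" using ins unfolding inserts_def by blast
  have adv: "advance (aug I a) (p a) \<in> {1..aug I a}"
    using instance_class(2,4)[OF I a] by (auto simp: advance_def)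
  have life: "lifetimes (cnt I a) (aug I a) (advance (aug I a) (p a)) ((L a)(p a := aug I a))"
    using con a by (intro lifetimes_advance) (auto simp: consistent_def)
  \<comment> \<open>Since \<theta> is the least slack, no counter is pushed above its
    weight.\<close>
  have c: "0 \<le> c' j v \<and> c' j v \<le> wt I j" if j: "j \<in> {1..nclasses I}" for j v
  proof -
    have "c' j = (c j)(r := if j = a then 0 else c j r + (wt I a - c a r))"
      "wt I a - c a r \<le> wt I j - c j r"
      using ins j unfolding inserts_def by blast+
    moreover have "\<And>v. 0 \<le> c j v \<and> c j v \<le> wt I j" "0 \<le> c a r \<and> c a r \<le> wt I a"
      using con j a unfolding consistent_def by blast+
    ultimately show ?thesis using instance_class(3)[OF I a] by auto
  qed
  have "placed I (aug I) x'"
    using con ins r unfolding consistent_def inserts_def placed_def by auto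
  moreover have "p' j \<in> {1..aug I j} \<and>
      lifetimes (cnt I j) (aug I j) (p' j) ((L(a := (L a)(p a := aug I a))) j)"
    if "j \<in> {1..nclasses I}" for j
    using that con ins adv life unfolding consistent_def inserts_def by (cases "j = a") auto
  ultimately show ?thesis using c unfolding consistent_def by blast
qed

text \<open>The debt part changes by at most \<open>3 / 2 * wt I a - 2 * l * \<theta>\<close> and
  the counter part by exactly \<open>2 * l * \<theta> - 2 * wt I a\<close>, where
  \<open>l = nclasses I\<close>; the terms in \<theta> cancel and \<open>- wt I a / 2\<close> is
  left.\<close>

lemma potential_inserts:
  assumes I: "wks_instance I" and con: "consistent I x p c L"
    and unc: "\<not> covers I (aug I) r x" and ins: "inserts I r a x p c x' p' c'"
    and r: "r \<in> points I" and cov: "covers I (cnt I) r y"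
  shows "potential I x' p' c' (L(a := (L a)(p a := aug I a))) y + wt I a / 2 \<le> potential I x p c L y"
proof -
  let ?l = "real (nclasses I)" and ?L = "L(a := (L a)(p a := aug I a))" and ?th = "wt I a - c a r"
  have a: "a \<in> {1..nclasses I}" using ins unfolding inserts_def by blast
  have l: "1 \<le> ?l" using instance_class(1)[OF I a] by simp
  have th: "0 \<le> ?th" using con a unfolding consistent_def by auto
  \<comment> \<open>The offline solution serves \<open>r\<close>, so in some class the debt at
    \<open>r\<close> is counted and drops by \<theta>.\<close>
  obtain b where b: "b \<in> {1..nclasses I}" "r \<in> y b ` {1..cnt I b}"
    using cov unfolding covers_def by force
  have "(\<Sum>j = 1..nclasses I. \<Sum>v\<in>y j ` {1..cnt I j}. debt I x' p' c' ?L j v)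
      \<le> (\<Sum>j = 1..nclasses I. (\<Sum>v\<in>y j ` {1..cnt I j}. debt I x p c L j v)
        + (if j = a then 3 / (4 * ?l) * wt I a else 0) - (if j = b then ?th else 0))"
  proof (rule sum_mono)
    fix j assume j: "j \<in> {1..nclasses I}"
    have "card (y j ` {1..cnt I j}) \<le> cnt I j" using card_image_le[of "{1..cnt I j}"] by simp
    from sum_debt_inserts[OF I con unc ins j _ this] b(2) th
    show "(\<Sum>v\<in>y j ` {1..cnt I j}. debt I x' p' c' ?L j v) \<le>
      (\<Sum>v\<in>y j ` {1..cnt I j}. debt I x p c L j v)
        + (if j = a then 3 / (4 * ?l) * wt I a else 0) - (if j = b then ?th else 0)"
      by (smt (verit) finite_atLeastAtMost finite_imageI)
  qed
  also have "\<dots> = (\<Sum>j = 1..nclasses I. \<Sum>v\<in>y j ` {1..cnt I j}. debt I x p c L j v)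
      + 3 / (4 * ?l) * wt I a - ?th"
    using a b(1) by (simp add: sum.distrib sum_subtractf)
  finally have "2 * ?l * (\<Sum>j = 1..nclasses I. \<Sum>v\<in>y j ` {1..cnt I j}. debt I x' p' c' ?L j v)
      \<le> 2 * ?l * ((\<Sum>j = 1..nclasses I. \<Sum>v\<in>y j ` {1..cnt I j}. debt I x p c L j v)
        + 3 / (4 * ?l) * wt I a - ?th)"
    using l by (intro mult_left_mono) auto
  also have "\<dots> = 2 * ?l * (\<Sum>j = 1..nclasses I. \<Sum>v\<in>y j ` {1..cnt I j}. debt I x p c L j v)
      + 3 / 2 * wt I a - 2 * ?l * ?th"
    using l by (simp add: field_simps)
  finally have debts: "2 * ?l * (\<Sum>j = 1..nclasses I. \<Sum>v\<in>y j ` {1..cnt I j}. debt I x' p' c' ?L j v)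
      \<le> 2 * ?l * (\<Sum>j = 1..nclasses I. \<Sum>v\<in>y j ` {1..cnt I j}. debt I x p c L j v)
      + 3 / 2 * wt I a - 2 * ?l * ?th" .
  have fin: "finite (points I)" unfolding points_def by simp
  \<comment> \<open>In class \<open>a\<close>, resetting the counter amounts to raising it by
    \<theta>, up to \<open>wt I a\<close>, and then subtracting \<open>wt I a\<close>.\<close>
  have "(\<Sum>v\<in>points I. c' j v) = (\<Sum>v\<in>points I. c j v) + ?th - (if j = a then wt I a else 0)"
    if j: "j \<in> {1..nclasses I}" for j
  proof -
    have "c' j = (c j)(r := if j = a then 0 else c j r + ?th)"
      using ins j unfolding inserts_def by blast
    then show ?thesis
      by (simp add: sum.remove[OF fin r])
  qed
  then have "(\<Sum>j = 1..nclasses I. \<Sum>v\<in>points I. c' j v)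
      = (\<Sum>j = 1..nclasses I. (\<Sum>v\<in>points I. c j v) + ?th - (if j = a then wt I a else 0))"
    by (intro sum.cong) auto
  also have "\<dots> = (\<Sum>j = 1..nclasses I. \<Sum>v\<in>points I. c j v) + ?l * ?th - wt I a"
    using a by (simp add: sum.distrib sum_subtractf)
  finally show ?thesis
    using debts unfolding potential_def by simp
qed

lemma move_cost_inserts:
  assumes I: "wks_instance I" and ins: "inserts I r a x p c x' p' c'"
  shows "move_cost I (aug I) x x' \<le> wt I a / 2"
proof -
  have a: "a \<in> {1..nclasses I}" and x': "x' = x(a := (x a)(p a := r))"
    using ins unfolding inserts_def by auto
  have w: "0 \<le> wt I a" by (rule instance_class(3)[OF I a])
  have "(\<Sum>j = 1..nclasses I. \<Sum>i = 1..aug I j. wt I j * (if x j i \<noteq> x' j i then 1 else 0))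
      \<le> (\<Sum>j = 1..nclasses I. if j = a then wt I a else 0)"
  proof (intro sum_mono)
    fix j
    have "(\<Sum>i = 1..aug I a. wt I a * (if x a i \<noteq> x' a i then 1 else 0))
        \<le> (\<Sum>i = 1..aug I a. if i = p a then wt I a else 0)"
      using w by (intro sum_mono) (auto simp: x')
    also have "\<dots> \<le> wt I a" using w by simp
    finally show "(\<Sum>i = 1..aug I j. wt I j * (if x j i \<noteq> x' j i then 1 else 0))
        \<le> (if j = a then wt I a else 0)"
      by (auto simp: x')
  qed
  with a show ?thesis by (simp add: move_cost_def)
qed

lemma move_cost_same: "move_cost I \<kappa> x x = 0"
  by (simp add: move_cost_def)

text \<open>The amortized step: a hit changes nothing, and on a miss the drop of the potential pays
  for the insertion. The new lifetimes are existential because the machine does not store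
  them.\<close>

lemma serves_step:
  assumes I: "wks_instance I" and con: "consistent I x p c L" and r: "r \<in> points I"
    and s: "serves I r x p c x' p' c'"
  obtains L' where "consistent I x' p' c' L'" "covers I (aug I) r x'"
    "\<And>y. covers I (cnt I) r y \<Longrightarrow>
       move_cost I (aug I) x x' + potential I x' p' c' L' y \<le> potential I x p c L y"
proof (cases "covers I (aug I) r x")
  case True
  with s con that[of L] show thesis unfolding serves_def by (simp add: move_cost_same)
next
  case False
  with s obtain a where ins: "inserts I r a x p c x' p' c'" unfolding serves_def by auto
  then have a: "a \<in> {1..nclasses I}" and "x' a (p a) = r" unfolding inserts_def by auto
  moreover have "p a \<in> {1..aug I a}" using con a unfolding consistent_def by blast
  ultimately have "covers I (aug I) r x'" unfolding covers_def by blast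
  with consistent_inserts[OF I con ins r] potential_inserts[OF I con False ins r]
    move_cost_inserts[OF I ins] that
  show thesis by (smt (verit, best))
qed


section \<open>The programs\<close>

primrec loop_free :: "com \<Rightarrow> bool" where
  "loop_free SKIP \<longleftrightarrow> True"
| "loop_free (NSet x a b e) \<longleftrightarrow> True"
| "loop_free (RSet x a b e) \<longleftrightarrow> True"
| "loop_free (Flip x) \<longleftrightarrow> False"
| "loop_free (Seq c d) \<longleftrightarrow> loop_free c \<and> loop_free d"
| "loop_free (Cond b c d) \<longleftrightarrow> loop_free c \<and> loop_free d"
| "loop_free (While b c) \<longleftrightarrow> False"

primrec exec :: "com \<Rightarrow> store \<Rightarrow> store" where
  "exec SKIP s = s"
| "exec (NSet x a b e) s = put_nat x (nval s a) (nval s b) (nval s e) s"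
| "exec (RSet x a b e) s = put_real x (nval s a) (nval s b) (rval s e) s"
| "exec (Flip x) s = s"
| "exec (Seq c d) s = exec d (exec c s)"
| "exec (Cond b c d) s = (if bval s b then exec c s else exec d s)"
| "exec (While b c) s = s"

primrec max_time :: "com \<Rightarrow> nat" where
  "max_time SKIP = 0"
| "max_time (NSet x a b e) = 1"
| "max_time (RSet x a b e) = 1"
| "max_time (Flip x) = 1"
| "max_time (Seq c d) = max_time c + (max_time d + 1)"
| "max_time (Cond b c d) = max_time c + max_time d + 1"
| "max_time (While b c) = 0"

text \<open>Straight-line code can thus be verified by simplifying \<open>exec\<close>. The
  predicate \<open>loop_free\<close> excludes \<open>Flip\<close> and \<open>While\<close>, on which
  \<open>exec\<close> is the identity.\<close>

lemma runs_exec: "loop_free c \<Longrightarrow> Q (exec c s) \<Longrightarrow> runs c (max_time c) s Q"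
proof (induction c arbitrary: s Q)
  case SKIP
  then show ?case using runs_SKIP[of Q s] by simp
next
  case (NSet x a b e)
  then show ?case using runs_NSet[of Q x s a b e] by simp
next
  case (RSet x a b e)
  then show ?case using runs_RSet[of Q x s a b e] by simp
next
  case (Seq c d)
  then have "runs c (max_time c) s (\<lambda>s'. runs d (max_time d) s' Q)" by simp
  then show ?case unfolding max_time.simps by (rule runs_Seq)
next
  case (Cond b c d)
  then show ?case unfolding max_time.simps by (intro runs_Cond) simp_all
qed simp_all

lemma runs_loop_free: "Q (exec c s) \<Longrightarrow> loop_free c \<Longrightarrow> max_time c \<le> T \<Longrightarrow> runs c T s Q"
  by (rule runs_weaken[OF runs_exec])

lemma runs_SeqI:
  assumes "runs c T1 s R" "\<And>s'. R s' \<Longrightarrow> runs d T2 s' Q" "T1 + T2 + 1 \<le> T"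
  shows "runs (Seq c d) T s Q"
  using runs_weaken[OF assms(1) order_refl assms(2)] assms(3)
  by (intro runs_weaken[OF runs_Seq]) auto

lemma runs_WhileI:
  assumes "Inv 0 s"
    and "\<And>m s. m < M \<Longrightarrow> Inv m s \<Longrightarrow> bval s b"
    and "\<And>m s. m < M \<Longrightarrow> Inv m s \<Longrightarrow> runs c T s (Inv (Suc m))"
    and "\<And>s. Inv M s \<Longrightarrow> \<not> bval s b"
    and "\<And>s. Inv M s \<Longrightarrow> Q s"
    and "M * (T + 2) + 1 \<le> T'"
  shows "runs (While b c) T' s Q"
  using assms by (intro runs_weaken[OF runs_While[of Inv s M b c T Q]]) auto

section \<open>The program texts\<close>

abbreviation scalar :: "string \<Rightarrow> nexp" where
  "scalar x \<equiv> NCell x (NConst 0) (NConst 0)"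

abbreviation assign :: "string \<Rightarrow> nexp \<Rightarrow> com" where
  "assign x \<equiv> NSet x (NConst 0) (NConst 0)"

abbreviation increment :: "string \<Rightarrow> com" where
  "increment x \<equiv> assign x (NAdd (scalar x) (NConst 1))"

abbreviation vec :: "string \<Rightarrow> string \<Rightarrow> nexp" where
  "vec x i \<equiv> NCell x (scalar i) (NConst 0)"

abbreviation at_most :: "nexp \<Rightarrow> nexp \<Rightarrow> bexp" where
  "at_most a b \<equiv> BNot (NLess b a)"

text \<open>Naturals can only be added, so \<open>2 * l * k\<close> is computed by adding
  \<open>k + k\<close> in each of \<open>l\<close> rounds.\<close>

definition size_loop :: com where
  "size_loop = While (NLess (scalar ''i'') (scalar ''l''))
     (Seq (NSet ''K'' (scalar ''j'') (NConst 0) (NAdd (vec ''K'' ''j'') (NAdd (vec ''k'' ''j'') (vec ''k'' ''j''))))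
          (increment ''i''))"

definition fill_loop :: com where
  "fill_loop = While (at_most (scalar ''i'') (vec ''K'' ''j''))
     (Seq (NSet ''pos'' (scalar ''j'') (scalar ''i'') (NConst 1)) (increment ''i''))"

text \<open>The given servers keep slots \<open>1\<close> to \<open>k\<close> and the additional
  ones are parked at point 1. The queue pointer starts at \<open>k + 1\<close>, so the parked
  servers are the first to be moved.\<close>

definition init_class :: com where
  "init_class =
     Seq (Seq (NSet ''K'' (scalar ''j'') (NConst 0) (NConst 0)) (assign ''i'' (NConst 0)))
    (Seq size_loop
    (Seq (Seq (NSet ''p'' (scalar ''j'') (NConst 0) (NAdd (vec ''k'' ''j'') (NConst 1)))
              (assign ''i'' (NAdd (vec ''k'' ''j'') (NConst 1))))
    (Seq fill_loop
         (increment ''j''))))"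

definition init_prog :: com where
  "init_prog = Seq (assign ''j'' (NConst 1))
     (While (at_most (scalar ''j'') (scalar ''l'')) init_class)"

text \<open>Tests offer only strict comparison, so equality is expressed by two
  inequalities.\<close>

definition scan_slots :: com where
  "scan_slots = While (at_most (scalar ''i'') (vec ''K'' ''j''))
     (Seq (Cond (BAnd (at_most (NCell ''pos'' (scalar ''j'') (scalar ''i'')) (scalar ''req''))
                      (at_most (scalar ''req'') (NCell ''pos'' (scalar ''j'') (scalar ''i''))))
                (assign ''f'' (NConst 1)) SKIP)
          (increment ''i''))"

definition scan_prog :: com where
  "scan_prog = Seq (Seq (assign ''f'' (NConst 0)) (assign ''j'' (NConst 1)))
     (While (at_most (scalar ''j'') (scalar ''l''))
        (Seq (assign ''i'' (NConst 1)) (Seq scan_slots (increment ''j''))))"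

definition slack :: "string \<Rightarrow> rexp" where
  "slack x = RSub (RCell ''W'' (scalar x) (NConst 0)) (RCell ''c'' (scalar x) (scalar ''req''))"

definition choose_prog :: com where
  "choose_prog = Seq (Seq (assign ''a'' (NConst 1)) (assign ''j'' (NConst 1)))
     (While (at_most (scalar ''j'') (scalar ''l''))
        (Seq (Cond (RLess (slack ''j'') (slack ''a'')) (assign ''a'' (scalar ''j'')) SKIP)
             (increment ''j'')))"

text \<open>The growth \<theta> is saved in \<open>t\<close> first, because the loop overwrites the
  counter of class \<open>a\<close> from which it is computed.\<close>

definition charge_prog :: com where
  "charge_prog = Seq (Seq (RSet ''t'' (NConst 0) (NConst 0) (slack ''a'')) (assign ''j'' (NConst 1)))
     (While (at_most (scalar ''j'') (scalar ''l''))
        (Seq (RSet ''c'' (scalar ''j'') (scalar ''req'')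
                (RAdd (RCell ''c'' (scalar ''j'') (scalar ''req'')) (RCell ''t'' (NConst 0) (NConst 0))))
             (increment ''j'')))"

definition insert_prog :: com where
  "insert_prog = Seq (RSet ''c'' (scalar ''a'') (scalar ''req'') (RNat (NConst 0)))
    (Seq (NSet ''pos'' (scalar ''a'') (vec ''p'' ''a'') (scalar ''req''))
         (Cond (NLess (vec ''p'' ''a'') (vec ''K'' ''a''))
            (NSet ''p'' (scalar ''a'') (NConst 0) (NAdd (vec ''p'' ''a'') (NConst 1)))
            (NSet ''p'' (scalar ''a'') (NConst 0) (NConst 1))))"

definition serve_prog :: com where
  "serve_prog = Seq scan_prog
     (Cond (NLess (scalar ''f'') (NConst 1)) (Seq choose_prog (Seq charge_prog insert_prog)) SKIP)"

text \<open>Only arrays of naturals are framed; what happens to the real arrays is stated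
  separately.\<close>

definition frame :: "string set \<Rightarrow> store \<Rightarrow> store \<Rightarrow> bool" where
  "frame X s s' \<longleftrightarrow> (\<forall>x. x \<notin> X \<longrightarrow> nats s' x = nats s x)"

section \<open>Timed correctness of the initialization\<close>

lemma runs_size_loop:
  assumes "nats s ''i'' 0 0 = 0" "nats s ''K'' (nats s ''j'' 0 0) 0 = 0"
  shows "runs size_loop (nats s ''l'' 0 0 * 5 + 1) s
    (\<lambda>s'. frame {''K'', ''i''} s s' \<and> reals s' = reals s \<and>
       nats s' ''K'' = (nats s ''K'')(nats s ''j'' 0 0 := (nats s ''K'' (nats s ''j'' 0 0))
         (0 := 2 * nats s ''l'' 0 0 * nats s ''k'' (nats s ''j'' 0 0) 0)))"
  unfolding size_loop_def
proof (rule runs_WhileI[where M = "nats s ''l'' 0 0" and T = 3 and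
        Inv = "\<lambda>m s'. frame {''K'', ''i''} s s' \<and> reals s' = reals s \<and> nats s' ''i'' 0 0 = m \<and>
          nats s' ''K'' = (nats s ''K'')(nats s ''j'' 0 0 := (nats s ''K'' (nats s ''j'' 0 0))
            (0 := 2 * m * nats s ''k'' (nats s ''j'' 0 0) 0))"], goal_cases)
  case 1
  have "(nats s ''K'' (nats s ''j'' 0 0))(0 := 0) = nats s ''K'' (nats s ''j'' 0 0)"
    using assms(2) by (rule fun_upd_idem)
  then show ?case using assms by (simp add: frame_def)
next
  case (3 m s')
  then show ?case
    by (intro runs_loop_free) (simp_all add: frame_def algebra_simps)
qed (simp_all add: frame_def)

lemma runs_fill_loop:
  assumes "nats s ''i'' 0 0 = Suc k" "k \<le> nats s ''K'' (nats s ''j'' 0 0) 0"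
    "nats s ''K'' (nats s ''j'' 0 0) 0 \<le> A"
  shows "runs fill_loop (A * 5 + 1) s
    (\<lambda>s'. frame {''pos'', ''i''} s s' \<and> reals s' = reals s \<and>
       nats s' ''pos'' = (\<lambda>j i. if j = nats s ''j'' 0 0 \<and> i \<in> {k<..nats s ''K'' j 0} then 1 else nats s ''pos'' j i))"
  unfolding fill_loop_def
proof (rule runs_WhileI[where M = "nats s ''K'' (nats s ''j'' 0 0) 0 - k" and T = 3 and
        Inv = "\<lambda>m s'. frame {''pos'', ''i''} s s' \<and> reals s' = reals s \<and> nats s' ''i'' 0 0 = Suc (k + m) \<and>
          nats s' ''pos'' = (\<lambda>j i. if j = nats s ''j'' 0 0 \<and> i \<in> {k<..k + m} then 1 else nats s ''pos'' j i)"],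
    goal_cases)
  case (3 m s')
  then show ?case
    by (intro runs_loop_free) (auto simp: frame_def fun_eq_iff)
next
  case (5 s')
  then show ?case using assms by (auto simp: fun_eq_iff)
qed (use assms in \<open>auto simp: frame_def\<close>)

lemma runs_init_class:
  fixes s :: store
  defines "j \<equiv> nats s ''j'' 0 0" and "l \<equiv> nats s ''l'' 0 0"
  defines "k \<equiv> nats s ''k'' j 0"
  assumes "k \<le> 2 * l * k" "2 * l * k \<le> A"
  shows "runs init_class (l * 5 + A * 5 + 20) s
    (\<lambda>s'. frame {''K'', ''i'', ''p'', ''pos'', ''j''} s s' \<and> reals s' = reals s \<and> nats s' ''j'' 0 0 = Suc j \<and>
       nats s' ''K'' = (nats s ''K'')(j := (nats s ''K'' j)(0 := 2 * l * k)) \<and>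
       nats s' ''p'' = (nats s ''p'')(j := (nats s ''p'' j)(0 := k + 1)) \<and>
       nats s' ''pos'' = (\<lambda>j' i. if j' = j \<and> i \<in> {k<..2 * l * k} then 1 else nats s ''pos'' j' i))"
    (is "runs _ _ _ ?Q")
proof -
  let ?c1 = "Seq (NSet ''K'' (scalar ''j'') (NConst 0) (NConst 0)) (assign ''i'' (NConst 0))"
  let ?c2 = "Seq (NSet ''p'' (scalar ''j'') (NConst 0) (NAdd (vec ''k'' ''j'') (NConst 1)))
              (assign ''i'' (NAdd (vec ''k'' ''j'') (NConst 1)))"
  \<comment> \<open>These are the assertions after \<open>size_loop\<close>, after the assignments
    \<open>?c2\<close> and after \<open>fill_loop\<close>, all relative to the initial store
    \<open>s\<close>.\<close>
  let ?R1 = "\<lambda>s1. frame {''K'', ''i''} s s1 \<and> reals s1 = reals s \<and>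
      nats s1 ''K'' = (nats s ''K'')(j := (nats s ''K'' j)(0 := 2 * l * k))"
  let ?R2 = "\<lambda>s2. frame {''K'', ''i'', ''p''} s s2 \<and> reals s2 = reals s \<and>
      nats s2 ''K'' = (nats s ''K'')(j := (nats s ''K'' j)(0 := 2 * l * k)) \<and>
      nats s2 ''p'' = (nats s ''p'')(j := (nats s ''p'' j)(0 := k + 1)) \<and> nats s2 ''i'' 0 0 = Suc k"
  let ?R3 = "\<lambda>s3. frame {''K'', ''i'', ''p'', ''pos''} s s3 \<and> reals s3 = reals s \<and>
      nats s3 ''K'' = (nats s ''K'')(j := (nats s ''K'' j)(0 := 2 * l * k)) \<and>
      nats s3 ''p'' = (nats s ''p'')(j := (nats s ''p'' j)(0 := k + 1)) \<and>
      nats s3 ''pos'' = (\<lambda>j' i. if j' = j \<and> i \<in> {k<..2 * l * k} then 1 else nats s ''pos'' j' i)"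
  have 1: "runs ?c1 3 s (\<lambda>s1. s1 = exec ?c1 s)"
    by (rule runs_loop_free) simp_all
  have 2: "runs size_loop (l * 5 + 1) s1 ?R1" if "s1 = exec ?c1 s" for s1
    unfolding that by (rule runs_weaken[OF runs_size_loop]) (simp_all add: frame_def j_def l_def k_def)
  have 3: "runs ?c2 3 s1 ?R2" if "?R1 s1" for s1
    using that by (intro runs_loop_free) (simp_all add: frame_def j_def l_def k_def)
  have 4: "runs fill_loop (A * 5 + 1) s2 ?R3" if R: "?R2 s2" for s2
  proof (rule runs_weaken[OF runs_fill_loop[of s2 k A] order_refl], goal_cases)
    case (4 s3)
    have "nats s2 ''j'' 0 0 = j" "nats s2 ''pos'' = nats s ''pos''"
      using R by (simp_all add: frame_def j_def)
    then show ?case using 4 R by (simp add: frame_def fun_eq_iff)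
  qed (use R assms in \<open>simp_all add: frame_def\<close>)
  have 5: "runs (increment ''j'') 1 s3 ?Q" if "?R3 s3" for s3
    using that by (intro runs_loop_free) (simp_all add: frame_def j_def)
  show ?thesis
    unfolding init_class_def
    by (rule runs_SeqI[OF 1 runs_SeqI[OF 2 runs_SeqI[OF 3 runs_SeqI[OF 4 5 order_refl] order_refl] order_refl]])
       simp_all
qed

text \<open>The part of the memory that the initialization provides and that serving a request
  leaves unchanged.\<close>

definition ready :: "wks \<Rightarrow> store \<Rightarrow> bool" where
  "ready I s \<longleftrightarrow> nats s ''l'' 0 0 = nclasses I \<and>
     (\<forall>j\<in>{1..nclasses I}. nats s ''K'' j 0 = aug I j \<and> reals s ''W'' j 0 = wt I j)"

definition start_config :: "wks \<Rightarrow> config" where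
  "start_config I j i =
     (if j \<in> {1..nclasses I} \<and> i \<in> {cnt I j<..aug I j} then 1 else nats (load I) ''pos'' j i)"

text \<open>\<open>A\<close> bounds the slot counts of all classes at once, which gives every
  iteration over the classes the same time bound.\<close>

lemma runs_init_prog:
  assumes I: "wks_instance I" and A: "\<And>j. j \<in> {1..nclasses I} \<Longrightarrow> aug I j \<le> A"
  shows "runs init_prog (nclasses I * (nclasses I * 5 + A * 5 + 22) + 3) (load I)
    (\<lambda>s. ready I s \<and> nats s ''pos'' = start_config I \<and> reals s ''c'' = (\<lambda>_ _. 0) \<and>
       (\<forall>j\<in>{1..nclasses I}. nats s ''p'' j 0 = Suc (cnt I j)))"
    (is "runs _ _ _ ?Q")
proof -
  let ?l = "nclasses I"
  let ?Inv = "\<lambda>m s. nats s ''l'' = nats (load I) ''l'' \<and> nats s ''k'' = nats (load I) ''k'' \<and>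
     reals s = reals (load I) \<and> nats s ''j'' 0 0 = Suc m \<and>
     (\<forall>j\<in>{1..m}. nats s ''K'' j 0 = aug I j \<and> nats s ''p'' j 0 = Suc (cnt I j)) \<and>
     nats s ''pos'' = (\<lambda>j i. if j \<in> {1..m} \<and> i \<in> {cnt I j<..aug I j} then 1 else nats (load I) ''pos'' j i)"
  have l: "nats (load I) ''l'' 0 0 = ?l" by (simp add: load_def)
  have "runs (assign ''j'' (NConst 1)) 1 (load I) (?Inv 0)"
    by (rule runs_loop_free) simp_all
  moreover have "runs (While (at_most (scalar ''j'') (scalar ''l'')) init_class)
      (?l * (?l * 5 + A * 5 + 22) + 1) s ?Q" if "?Inv 0 s" for s
  proof (rule runs_WhileI[where Inv = ?Inv and M = ?l and T = "?l * 5 + A * 5 + 20"], goal_cases)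
    case (3 m s)
    then have m: "Suc m \<in> {1..?l}" by simp
    have k: "nats (load I) ''k'' (Suc m) 0 = cnt I (Suc m)" using m by (simp add: load_def)
    have le: "cnt I (Suc m) \<le> aug I (Suc m)" using instance_class(4)[OF I m] by simp
    have s: "nats s ''j'' 0 0 = Suc m" "nats s ''l'' 0 0 = ?l" "nats s ''k'' (Suc m) 0 = cnt I (Suc m)"
      using 3 l k by simp_all
    show ?case
    proof (rule runs_weaken[OF runs_init_class[of s A]], goal_cases)
      case (4 s')
      have pos0: "nats s ''pos'' = (\<lambda>j i. if j \<in> {1..m} \<and> i \<in> {cnt I j<..aug I j} then 1
          else nats (load I) ''pos'' j i)"
        using 3 by blast
      have pos: "nats s' ''pos'' = (\<lambda>j' i. if j' = Suc m \<and> i \<in> {cnt I (Suc m)<..aug I (Suc m)}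
          then 1 else nats s ''pos'' j' i)"
        and K: "nats s' ''K'' = (nats s ''K'')(Suc m := (nats s ''K'' (Suc m))(0 := aug I (Suc m)))"
        and p: "nats s' ''p'' = (nats s ''p'')(Suc m := (nats s ''p'' (Suc m))(0 := cnt I (Suc m) + 1))"
        using 4 unfolding s aug_def by simp_all
      have "nats s' ''pos'' = (\<lambda>j i. if j \<in> {1..Suc m} \<and> i \<in> {cnt I j<..aug I j} then 1
          else nats (load I) ''pos'' j i)"
        unfolding pos pos0 by (auto simp: fun_eq_iff le_Suc_eq)
      moreover have "\<forall>j\<in>{1..Suc m}. nats s' ''K'' j 0 = aug I j \<and> nats s' ''p'' j 0 = Suc (cnt I j)"
        using 3 unfolding K p by auto
      moreover have "nats s' ''l'' = nats s ''l''" "nats s' ''k'' = nats s ''k''" "reals s' = reals s"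
        "nats s' ''j'' 0 0 = Suc (Suc m)"
        using 4 s by (simp_all add: frame_def)
      ultimately show ?case using 3 by simp
    qed (use le A[OF m] in \<open>simp_all add: s aug_def\<close>)
  next
    case (5 s)
    then have "reals s ''W'' j 0 = wt I j" if "j \<in> {1..?l}" for j
      using that by (simp add: load_def)
    moreover have "nats s ''pos'' = start_config I"
      using 5 by (simp add: start_config_def fun_eq_iff)
    moreover have "reals s ''c'' = (\<lambda>_ _. 0)" using 5 by (simp add: load_def)
    ultimately show ?case using 5 l unfolding ready_def by simp
  qed (use that l in simp_all)
  ultimately show ?thesis
    unfolding init_prog_def by (rule runs_SeqI) simp_all
qed

section \<open>Timed correctness of serving one request\<close>

lemma runs_scan_slots:
  fixes s :: store
  defines "j \<equiv> nats s ''j'' 0 0"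
  assumes "nats s ''i'' 0 0 = 1" "nats s ''K'' j 0 \<le> A"
  shows "runs scan_slots (A * 6 + 1) s
    (\<lambda>s'. frame {''f'', ''i''} s s' \<and> reals s' = reals s \<and>
       nats s' ''f'' 0 0 = (if \<exists>i\<in>{1..nats s ''K'' j 0}. nats s ''pos'' j i = nats s ''req'' 0 0
         then 1 else nats s ''f'' 0 0))"
  unfolding scan_slots_def
proof (rule runs_WhileI[where M = "nats s ''K'' j 0" and T = 4 and
    Inv = "\<lambda>m s'. frame {''f'', ''i''} s s' \<and> reals s' = reals s \<and> nats s' ''i'' 0 0 = Suc m \<and>
       nats s' ''f'' 0 0 = (if \<exists>i\<in>{1..m}. nats s ''pos'' j i = nats s ''req'' 0 0
         then 1 else nats s ''f'' 0 0)"], goal_cases)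
  case (3 m s')
  have "(\<exists>i\<in>{1..Suc m}. nats s ''pos'' j i = nats s ''req'' 0 0) \<longleftrightarrow>
      (\<exists>i\<in>{1..m}. nats s ''pos'' j i = nats s ''req'' 0 0) \<or> nats s ''pos'' j (Suc m) = nats s ''req'' 0 0"
    by (subst atLeastAtMostSuc_conv) auto
  moreover have "nats s' ''j'' 0 0 = j" "nats s' ''pos'' = nats s ''pos''" "nats s' ''req'' = nats s ''req''"
    using 3 by (simp_all add: frame_def j_def)
  ultimately show ?case
    using 3 by (intro runs_loop_free) (auto simp: frame_def)
qed (use assms in \<open>simp_all add: frame_def\<close>)

lemma runs_scan_prog:
  assumes r: "ready I s" and A: "\<And>j. j \<in> {1..nclasses I} \<Longrightarrow> aug I j \<le> A"
  shows "runs scan_prog (nclasses I * (A * 6 + 7) + 5) s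
    (\<lambda>s'. frame {''f'', ''i'', ''j''} s s' \<and> reals s' = reals s \<and>
       nats s' ''f'' 0 0 = (if covers I (aug I) (nats s ''req'' 0 0) (nats s ''pos'') then 1 else 0))"
    (is "runs _ _ _ ?Q")
proof -
  let ?hit = "\<lambda>j. \<exists>i\<in>{1..aug I j}. nats s ''pos'' j i = nats s ''req'' 0 0"
  let ?Inv = "\<lambda>m s'. frame {''f'', ''i'', ''j''} s s' \<and> reals s' = reals s \<and> nats s' ''j'' 0 0 = Suc m \<and>
     nats s' ''f'' 0 0 = (if \<exists>j\<in>{1..m}. ?hit j then 1 else 0)"
  have "runs (Seq (assign ''f'' (NConst 0)) (assign ''j'' (NConst 1))) 3 s (?Inv 0)"
    by (rule runs_loop_free) (simp_all add: frame_def)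
  moreover have "runs (While (at_most (scalar ''j'') (scalar ''l''))
        (Seq (assign ''i'' (NConst 1)) (Seq scan_slots (increment ''j''))))
      (nclasses I * (A * 6 + 7) + 1) s0 ?Q" if "?Inv 0 s0" for s0
  proof (rule runs_WhileI[where Inv = ?Inv and M = "nclasses I" and T = "A * 6 + 5"], goal_cases)
    case (3 m s1)
    then have m: "Suc m \<in> {1..nclasses I}" by simp
    let ?R = "\<lambda>s2. frame {''f'', ''i'', ''j''} s s2 \<and> reals s2 = reals s \<and> nats s2 ''j'' 0 0 = Suc m \<and>
      nats s2 ''f'' 0 0 = (if \<exists>j\<in>{1..m}. ?hit j then 1 else 0)"
    have a1: "runs (assign ''i'' (NConst 1)) 1 s1 (\<lambda>s2. ?R s2 \<and> nats s2 ''i'' 0 0 = 1)"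
      using 3 by (intro runs_loop_free) (simp_all add: frame_def)
    have hits: "(\<exists>j\<in>{1..Suc m}. ?hit j) \<longleftrightarrow> (\<exists>j\<in>{1..m}. ?hit j) \<or> ?hit (Suc m)"
      by (subst atLeastAtMostSuc_conv) (simp, blast)
    have a2: "runs scan_slots (A * 6 + 1) s2 (\<lambda>s3. frame {''f'', ''i'', ''j''} s s3 \<and> reals s3 = reals s \<and>
        nats s3 ''j'' 0 0 = Suc m \<and> nats s3 ''f'' 0 0 = (if \<exists>j\<in>{1..Suc m}. ?hit j then 1 else 0))"
      if R: "?R s2 \<and> nats s2 ''i'' 0 0 = 1" for s2
    proof (rule runs_weaken[OF runs_scan_slots[of s2 A] order_refl], goal_cases)
      case 1
      then show ?case using R by simp
    next
      case 2
      then show ?case using R r A[OF m] m by (simp add: frame_def ready_def)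
    next
      case (3 s3)
      have "nats s2 ''j'' 0 0 = Suc m" "nats s2 ''pos'' = nats s ''pos''" "nats s2 ''req'' = nats s ''req''"
        "nats s2 ''K'' (Suc m) 0 = aug I (Suc m)"
        using R r m by (simp_all add: frame_def ready_def)
      with 3 R show ?case unfolding hits by (simp add: frame_def)
    qed
    have a3: "runs (increment ''j'') 1 s3 (?Inv (Suc m))"
      if "frame {''f'', ''i'', ''j''} s s3 \<and> reals s3 = reals s \<and>
        nats s3 ''j'' 0 0 = Suc m \<and> nats s3 ''f'' 0 0 = (if \<exists>j\<in>{1..Suc m}. ?hit j then 1 else 0)" for s3
      using that by (intro runs_loop_free) (simp_all add: frame_def)
    show ?case
      by (rule runs_SeqI[OF a1 runs_SeqI[OF a2 a3 order_refl]]) simp_all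
  qed (use that r in \<open>simp_all add: frame_def ready_def covers_def\<close>)
  ultimately show ?thesis
    unfolding scan_prog_def by (rule runs_SeqI) simp_all
qed

text \<open>A linear scan for the least slack. Starting with \<open>a = 1\<close> makes
  \<open>a\<close> a valid class before any comparison, as there is at least one class.\<close>

lemma runs_choose_prog:
  fixes s :: store
  defines "v \<equiv> nats s ''req'' 0 0"
  assumes r: "ready I s" and l: "1 \<le> nclasses I"
  shows "runs choose_prog (nclasses I * 6 + 5) s
    (\<lambda>s'. frame {''a'', ''j''} s s' \<and> reals s' = reals s \<and> nats s' ''a'' 0 0 \<in> {1..nclasses I} \<and>
       (\<forall>j\<in>{1..nclasses I}. wt I (nats s' ''a'' 0 0) - reals s ''c'' (nats s' ''a'' 0 0) v
          \<le> wt I j - reals s ''c'' j v))"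
    (is "runs _ _ _ ?Q")
proof -
  let ?sl = "\<lambda>j. wt I j - reals s ''c'' j v"
  let ?Inv = "\<lambda>m s'. frame {''a'', ''j''} s s' \<and> reals s' = reals s \<and> nats s' ''j'' 0 0 = Suc m \<and>
     nats s' ''a'' 0 0 \<in> {1..nclasses I} \<and> (\<forall>j\<in>{1..m}. ?sl (nats s' ''a'' 0 0) \<le> ?sl j)"
  have "runs (Seq (assign ''a'' (NConst 1)) (assign ''j'' (NConst 1))) 3 s (?Inv 0)"
    using l by (intro runs_loop_free) (simp_all add: frame_def)
  moreover have "runs (While (at_most (scalar ''j'') (scalar ''l''))
        (Seq (Cond (RLess (slack ''j'') (slack ''a'')) (assign ''a'' (scalar ''j'')) SKIP)
             (increment ''j''))) (nclasses I * 6 + 1) s0 ?Q" if "?Inv 0 s0" for s0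
  proof (rule runs_WhileI[where Inv = ?Inv and M = "nclasses I" and T = 4], goal_cases)
    case (3 m s1)
    have W: "reals s ''W'' j 0 = wt I j" if "j \<in> {1..nclasses I}" for j
      using r that unfolding ready_def by blast
    let ?a = "nats s1 ''a'' 0 0"
    \<comment> \<open>The minimizer once class \<open>Suc m\<close> has been examined; the strict
      comparison keeps the earlier class on ties.\<close>
    define a' where "a' = (if ?sl (Suc m) < ?sl ?a then Suc m else ?a)"
    have "rval s1 (slack ''j'') = ?sl (Suc m)" "rval s1 (slack ''a'') = ?sl ?a"
      using 3 by (simp_all add: slack_def frame_def W v_def)
    then have "bval s1 (RLess (slack ''j'') (slack ''a'')) \<longleftrightarrow> ?sl (Suc m) < ?sl ?a" by simp
    then have ex: "exec (Seq (Cond (RLess (slack ''j'') (slack ''a'')) (assign ''a'' (scalar ''j'')) SKIP)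
        (increment ''j'')) s1 = (if ?sl (Suc m) < ?sl ?a
          then put_nat ''j'' 0 0 (Suc (Suc m)) (put_nat ''a'' 0 0 (Suc m) s1)
          else put_nat ''j'' 0 0 (Suc (Suc m)) s1)"
      using 3 by (simp del: bval.simps)
    have "frame {''a'', ''j''} s (put_nat ''j'' 0 0 (Suc (Suc m)) (put_nat ''a'' 0 0 (Suc m) s1))"
      "frame {''a'', ''j''} s (put_nat ''j'' 0 0 (Suc (Suc m)) s1)"
      using 3 by (simp_all add: frame_def)
    moreover have "a' \<in> {1..nclasses I}" using 3 by (simp add: a'_def)
    moreover have "\<forall>j\<in>{1..Suc m}. ?sl a' \<le> ?sl j"
    proof
      fix j assume "j \<in> {1..Suc m}"
      then consider "j = Suc m" | "j \<in> {1..m}" by force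
      then show "?sl a' \<le> ?sl j"
      proof cases
        case 2
        then have "?sl ?a \<le> ?sl j" using 3 by blast
        then show ?thesis by (simp add: a'_def)
      qed (simp add: a'_def)
    qed
    ultimately have "?Inv (Suc m) (if ?sl (Suc m) < ?sl ?a
          then put_nat ''j'' 0 0 (Suc (Suc m)) (put_nat ''a'' 0 0 (Suc m) s1)
          else put_nat ''j'' 0 0 (Suc (Suc m)) s1)"
      using 3 by (cases "?sl (Suc m) < ?sl ?a") (simp_all only: a'_def if_True if_False, simp_all)
    then show ?case unfolding ex[symmetric] by (rule runs_loop_free) simp_all
  qed (use that r in \<open>simp_all add: frame_def ready_def\<close>)
  ultimately show ?thesis
    unfolding choose_prog_def by (rule runs_SeqI) simp_all
qed

lemma runs_charge_prog:
  fixes s :: store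
  defines "v \<equiv> nats s ''req'' 0 0" and "a \<equiv> nats s ''a'' 0 0"
  assumes r: "ready I s" and a: "a \<in> {1..nclasses I}"
  shows "runs charge_prog (nclasses I * 5 + 5) s
    (\<lambda>s'. frame {''j''} s s' \<and> reals s' ''W'' = reals s ''W'' \<and>
       reals s' ''c'' = (\<lambda>j u. if j \<in> {1..nclasses I} \<and> u = v
         then reals s ''c'' j u + (wt I a - reals s ''c'' a v) else reals s ''c'' j u))"
    (is "runs _ _ _ ?Q")
proof -
  let ?th = "wt I a - reals s ''c'' a v"
  let ?Inv = "\<lambda>m s'. frame {''j''} s s' \<and> reals s' ''W'' = reals s ''W'' \<and> reals s' ''t'' 0 0 = ?th \<and>
     nats s' ''j'' 0 0 = Suc m \<and>
     reals s' ''c'' = (\<lambda>j u. if j \<in> {1..m} \<and> u = v then reals s ''c'' j u + ?th else reals s ''c'' j u)"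
  have "reals s ''W'' a 0 = wt I a" using r a unfolding ready_def by blast
  then have "runs (Seq (RSet ''t'' (NConst 0) (NConst 0) (slack ''a'')) (assign ''j'' (NConst 1))) 3 s (?Inv 0)"
    by (intro runs_loop_free) (simp_all add: frame_def slack_def v_def a_def)
  moreover have "runs (While (at_most (scalar ''j'') (scalar ''l''))
        (Seq (RSet ''c'' (scalar ''j'') (scalar ''req'')
                (RAdd (RCell ''c'' (scalar ''j'') (scalar ''req'')) (RCell ''t'' (NConst 0) (NConst 0))))
             (increment ''j''))) (nclasses I * 5 + 1) s0 ?Q" if "?Inv 0 s0" for s0
  proof (rule runs_WhileI[where Inv = ?Inv and M = "nclasses I" and T = 3], goal_cases)
    case (3 m s1)
    then have "nats s1 ''req'' 0 0 = v" by (simp add: frame_def v_def)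
    then show ?case
      using 3 by (intro runs_loop_free) (auto simp: frame_def fun_eq_iff)
  qed (use that r in \<open>simp_all add: frame_def ready_def\<close>)
  ultimately show ?thesis
    unfolding charge_prog_def by (rule runs_SeqI) simp_all
qed

lemma runs_serve_prog:
  fixes s :: store
  defines "r \<equiv> nats s ''req'' 0 0"
  assumes I: "wks_instance I" and rdy: "ready I s" and A: "\<And>j. j \<in> {1..nclasses I} \<Longrightarrow> aug I j \<le> A"
  shows "runs serve_prog (nclasses I * (A * 6 + 18) + 40) s
    (\<lambda>s'. ready I s' \<and> serves I r (nats s ''pos'') (\<lambda>j. nats s ''p'' j 0) (reals s ''c'')
       (nats s' ''pos'') (\<lambda>j. nats s' ''p'' j 0) (reals s' ''c''))"
    (is "runs _ _ _ ?Q")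
proof -
  let ?l = "nclasses I"
  have l: "1 \<le> ?l" using I unfolding wks_instance_def by blast
  \<comment> \<open>The assertions \<open>?R1\<close>, \<open>?R2\<close> and \<open>?R3\<close>
    hold after scanning, choosing and charging. Each refers back to the store \<open>s\<close>
    before the request, since \<open>serves\<close> compares that store with the final one.\<close>
  let ?R1 = "\<lambda>s1. frame {''f'', ''i'', ''j''} s s1 \<and> reals s1 = reals s \<and>
    nats s1 ''f'' 0 0 = (if covers I (aug I) r (nats s ''pos'') then 1 else 0)"
  let ?c = "reals s ''c''"
  let ?min = "\<lambda>a. a \<in> {1..?l} \<and> (\<forall>j\<in>{1..?l}. wt I a - ?c a r \<le> wt I j - ?c j r)"
  let ?R2 = "\<lambda>s2. frame {''f'', ''i'', ''j'', ''a''} s s2 \<and> reals s2 = reals s \<and> ?min (nats s2 ''a'' 0 0)"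
  let ?R3 = "\<lambda>s3. frame {''f'', ''i'', ''j'', ''a''} s s3 \<and> reals s3 ''W'' = reals s ''W'' \<and>
    ?min (nats s3 ''a'' 0 0) \<and> reals s3 ''c'' = (\<lambda>j u. if j \<in> {1..?l} \<and> u = r
         then ?c j u + (wt I (nats s3 ''a'' 0 0) - ?c (nats s3 ''a'' 0 0) r) else ?c j u)"
  have 1: "runs scan_prog (?l * (A * 6 + 7) + 5) s ?R1"
    unfolding r_def by (rule runs_scan_prog[OF rdy A])
  have 2: "runs choose_prog (?l * 6 + 5) s1 ?R2" if R: "?R1 s1" for s1
  proof (rule runs_weaken[OF runs_choose_prog[OF _ l] order_refl])
    show "ready I s1" using R rdy by (simp add: ready_def frame_def)
    have eq: "nats s1 ''req'' = nats s ''req''" using R by (simp add: frame_def)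
    show "?R2 s2" if "frame {''a'', ''j''} s1 s2 \<and> reals s2 = reals s1 \<and> nats s2 ''a'' 0 0 \<in> {1..nclasses I} \<and>
       (\<forall>j\<in>{1..nclasses I}. wt I (nats s2 ''a'' 0 0) - reals s1 ''c'' (nats s2 ''a'' 0 0) (nats s1 ''req'' 0 0)
          \<le> wt I j - reals s1 ''c'' j (nats s1 ''req'' 0 0))" for s2
      using that R unfolding eq r_def by (simp add: frame_def)
  qed
  have 3: "runs charge_prog (?l * 5 + 5) s2 ?R3" if R: "?R2 s2" for s2
  proof (rule runs_weaken[OF runs_charge_prog[of I] order_refl])
    show "ready I s2" using R rdy by (simp add: ready_def frame_def)
    show "nats s2 ''a'' 0 0 \<in> {1..?l}" using R by blast
    fix s3 assume s3: "frame {''j''} s2 s3 \<and> reals s3 ''W'' = reals s2 ''W'' \<and>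
       reals s3 ''c'' = (\<lambda>j u. if j \<in> {1..?l} \<and> u = nats s2 ''req'' 0 0
         then reals s2 ''c'' j u + (wt I (nats s2 ''a'' 0 0)
           - reals s2 ''c'' (nats s2 ''a'' 0 0) (nats s2 ''req'' 0 0)) else reals s2 ''c'' j u)"
    have eqs: "nats s3 ''a'' = nats s2 ''a''" "nats s2 ''req'' 0 0 = r" "reals s2 = reals s"
      using R s3 by (simp_all add: frame_def r_def)
    show "?R3 s3" using R s3 unfolding eqs by (simp add: frame_def)
  qed
  have 4: "runs insert_prog 10 s3 ?Q" if R: "?R3 s3" and unc: "\<not> covers I (aug I) r (nats s ''pos'')" for s3
    unfolding insert_prog_def
  proof (rule runs_loop_free, goal_cases)
    case 1
    define a where "a = nats s3 ''a'' 0 0"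
    let ?s' = "exec (Seq (RSet ''c'' (scalar ''a'') (scalar ''req'') (RNat (NConst 0)))
      (Seq (NSet ''pos'' (scalar ''a'') (vec ''p'' ''a'') (scalar ''req''))
         (Cond (NLess (vec ''p'' ''a'') (vec ''K'' ''a''))
            (NSet ''p'' (scalar ''a'') (NConst 0) (NAdd (vec ''p'' ''a'') (NConst 1)))
            (NSet ''p'' (scalar ''a'') (NConst 0) (NConst 1))))) s3"
    have a: "?min a" using R unfolding a_def by blast
    have old: "nats s3 ''pos'' = nats s ''pos''" "nats s3 ''p'' = nats s ''p''" "nats s3 ''K'' = nats s ''K''"
      "nats s3 ''l'' = nats s ''l''" "nats s3 ''req'' 0 0 = r"
      using R by (simp_all add: frame_def r_def)
    have K: "nats s ''K'' a 0 = aug I a" using rdy a unfolding ready_def by blast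
    have "nats ?s' ''pos'' = (nats s ''pos'')(a := (nats s ''pos'' a)(nats s ''p'' a 0 := r))"
      by (simp add: old flip: a_def)
    moreover have "(\<lambda>j. nats ?s' ''p'' j 0) =
        (\<lambda>j. nats s ''p'' j 0)(a := advance (aug I a) (nats s ''p'' a 0))"
      by (auto simp: old K advance_def fun_eq_iff simp flip: a_def)
    moreover have "reals ?s' ''c'' j = (?c j)(r := if j = a then 0 else ?c j r + (wt I a - ?c a r))"
      if "j \<in> {1..?l}" for j
    proof -
      have "reals ?s' ''c'' = (reals s3 ''c'')(a := (reals s3 ''c'' a)(r := 0))"
        by (simp add: old flip: a_def)
      then show ?thesis
        using R that by (auto simp: fun_eq_iff simp flip: a_def)
    qed
    ultimately have "inserts I r a (nats s ''pos'') (\<lambda>j. nats s ''p'' j 0) ?c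
        (nats ?s' ''pos'') (\<lambda>j. nats ?s' ''p'' j 0) (reals ?s' ''c'')"
      using a unfolding inserts_def by blast
    moreover have "ready I ?s'"
      using rdy R by (simp add: ready_def old)
    ultimately show ?case using unc unfolding serves_def by auto
  qed simp_all
  \<comment> \<open>The bounds of the three stages plus two sequencing steps.\<close>
  have 5: "runs (Seq choose_prog (Seq charge_prog insert_prog)) (?l * 11 + 22) s1 ?Q"
    if "?R1 s1" "\<not> covers I (aug I) r (nats s ''pos'')" for s1
    by (rule runs_SeqI[OF 2 runs_SeqI[OF 3 4 order_refl]]) (use that in simp_all)
  have 6: "runs (Cond (NLess (scalar ''f'') (NConst 1)) (Seq choose_prog (Seq charge_prog insert_prog)) SKIP)
      (?l * 11 + 22 + 0 + 1) s1 ?Q" if R: "?R1 s1" for s1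
  proof (rule runs_Cond)
    assume "bval s1 (NLess (scalar ''f'') (NConst 1))"
    then show "runs (Seq choose_prog (Seq charge_prog insert_prog)) (?l * 11 + 22) s1 ?Q"
      using R by (intro 5) (auto split: if_splits)
  next
    assume "\<not> bval s1 (NLess (scalar ''f'') (NConst 1))"
    then have "covers I (aug I) r (nats s ''pos'')" using R by (auto split: if_splits)
    then have "?Q s1" using R rdy by (simp add: serves_def ready_def frame_def)
    then show "runs SKIP 0 s1 ?Q" by (rule runs_SKIP)
  qed
  show ?thesis
    unfolding serve_prog_def by (rule runs_SeqI[OF 1 6]) (simp_all add: algebra_simps)
qed


section \<open>Competitiveness\<close>

text \<open>Induction over the requests. The offline configuration \<open>y\<close> before the next
  request is universally quantified, so the induction hypothesis applies to the one reached after
  it; the remaining potential is dropped at the end, being nonnegative.\<close>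

lemma serve_competitive:
  assumes I: "wks_instance I" and A: "\<And>j. j \<in> {1..nclasses I} \<Longrightarrow> aug I j \<le> A"
    and B: "\<And>t. 1 \<le> t \<Longrightarrow> nclasses I * (A * 6 + 18) + 40 \<le> B t"
  shows "ready I s \<Longrightarrow> consistent I (nats s ''pos'') (\<lambda>j. nats s ''p'' j 0) (reals s ''c'') L \<Longrightarrow>
    set \<sigma> \<subseteq> points I \<Longrightarrow> 1 \<le> t \<Longrightarrow>
    \<exists>ms. serve serve_prog B \<sigma> t s = return_pmf ms \<and> all_halted ms \<and>
      list_all2 (\<lambda>r c. placed I (aug I) c \<and> covers I (aug I) r c) \<sigma> (map config_of ms) \<and>
      (\<forall>y ds. list_all2 (covers I (cnt I)) \<sigma> ds \<longrightarrow>
         cost I (aug I) (nats s ''pos'' # map config_of ms) \<le>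
         potential I (nats s ''pos'') (\<lambda>j. nats s ''p'' j 0) (reals s ''c'') L y
           + 4 * real (nclasses I) * cost I (cnt I) (y # ds))"
proof (induction \<sigma> arbitrary: s L t)
  case Nil
  then show ?case using potential_nonneg[OF I Nil.prems(2)] by (simp add: all_halted_def)
next
  case (Cons r \<sigma>)
  let ?s0 = "put_nat ''req'' 0 0 r s"
  have "ready I ?s0" using Cons.prems(1) by (simp add: ready_def)
  then obtain s' where
    steps: "steps (B t) (serve_prog, ?s0) = return_pmf (SKIP, s')" and rdy: "ready I s'" and
    srv: "serves I r (nats s ''pos'') (\<lambda>j. nats s ''p'' j 0) (reals s ''c'')
       (nats s' ''pos'') (\<lambda>j. nats s' ''p'' j 0) (reals s' ''c'')"
    using steps_if_runs[OF runs_serve_prog[OF I _ A] B[OF Cons.prems(4)], of ?s0] by auto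
  have r: "r \<in> points I" using Cons.prems(3) by simp
  obtain L' where con: "consistent I (nats s' ''pos'') (\<lambda>j. nats s' ''p'' j 0) (reals s' ''c'') L'"
    and cov: "covers I (aug I) r (nats s' ''pos'')"
    and pot: "\<And>y. covers I (cnt I) r y \<Longrightarrow> move_cost I (aug I) (nats s ''pos'') (nats s' ''pos'')
        + potential I (nats s' ''pos'') (\<lambda>j. nats s' ''p'' j 0) (reals s' ''c'') L' y
        \<le> potential I (nats s ''pos'') (\<lambda>j. nats s ''p'' j 0) (reals s ''c'') L y"
    using serves_step[OF I Cons.prems(2) r srv] by blast
  obtain ms where ms: "serve serve_prog B \<sigma> (Suc t) s' = return_pmf ms" "all_halted ms"
      "list_all2 (\<lambda>r c. placed I (aug I) c \<and> covers I (aug I) r c) \<sigma> (map config_of ms)"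
    and le: "\<And>y ds. list_all2 (covers I (cnt I)) \<sigma> ds \<Longrightarrow>
         cost I (aug I) (nats s' ''pos'' # map config_of ms) \<le>
         potential I (nats s' ''pos'') (\<lambda>j. nats s' ''p'' j 0) (reals s' ''c'') L' y
           + 4 * real (nclasses I) * cost I (cnt I) (y # ds)"
    using Cons.IH[OF rdy con, of "Suc t"] Cons.prems(3) by auto
  have "serve serve_prog B (r # \<sigma>) t s = return_pmf ((SKIP, s') # ms)"
    by (simp add: steps ms bind_return_pmf)
  moreover have "all_halted ((SKIP, s') # ms)" using ms by (simp add: all_halted_def)
  moreover have "list_all2 (\<lambda>r c. placed I (aug I) c \<and> covers I (aug I) r c) (r # \<sigma>)
      (map config_of ((SKIP, s') # ms))"
    using ms cov con by (simp add: config_of_def consistent_def)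
  moreover have "cost I (aug I) (nats s ''pos'' # map config_of ((SKIP, s') # ms)) \<le>
      potential I (nats s ''pos'') (\<lambda>j. nats s ''p'' j 0) (reals s ''c'') L y
        + 4 * real (nclasses I) * cost I (cnt I) (y # ds)"
    if "list_all2 (covers I (cnt I)) (r # \<sigma>) ds" for y ds
  proof -
    from that obtain d ds' where ds: "ds = d # ds'" "covers I (cnt I) r d" "list_all2 (covers I (cnt I)) \<sigma> ds'"
      by (auto simp: list_all2_Cons1)
    \<comment> \<open>The offline move from \<open>y\<close> to \<open>d\<close> is accounted for
      first, against the unchanged state of the algorithm; then \<open>r\<close> is served while
      \<open>d\<close> covers it.\<close>
    show ?thesis
      using pot[OF ds(2)] le[OF ds(3), of d] potential_opt_move[OF I Cons.prems(2), of d y]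
      by (simp add: ds(1) config_of_def algebra_simps)
  qed
  ultimately show ?case by blast
qed

text \<open>The first insertion goes to slot \<open>k + 1\<close>, so slot \<open>s \<le> k\<close>
  is overwritten by insertion number \<open>K - k + s\<close>. Taking this as its lifetime makes its
  initial fraction 1.\<close>

definition start_lifetimes :: "wks \<Rightarrow> nat \<Rightarrow> nat \<Rightarrow> nat" where
  "start_lifetimes I j s = (if s \<le> cnt I j then aug I j - cnt I j + s else 0)"

lemma remaining_start: "s \<le> k \<Longrightarrow> k < K \<Longrightarrow> remaining K (Suc k) s = K - k + s"
  by (simp add: remaining_def)

lemma start_config_start:
  "j \<in> {1..nclasses I} \<Longrightarrow> i \<in> {1..cnt I j} \<Longrightarrow> start_config I j i = start I j i"
  by (simp add: start_config_def load_def)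

lemma consistent_start:
  assumes I: "wks_instance I" and p: "\<And>j. j \<in> {1..nclasses I} \<Longrightarrow> p j = Suc (cnt I j)"
  shows "consistent I (start_config I) p (\<lambda>_ _. 0) (start_lifetimes I)"
proof -
  have "start_config I j i \<in> points I" if "j \<in> {1..nclasses I}" "i \<in> {1..aug I j}" for j i
  proof (cases "i \<le> cnt I j")
    case True
    then show ?thesis using I that start_config_start[of j I i] unfolding wks_instance_def by auto
  next
    case False
    then show ?thesis using I that unfolding wks_instance_def by (simp add: start_config_def points_def)
  qed
  moreover have "p j \<in> {1..aug I j}" "lifetimes (cnt I j) (aug I j) (p j) (start_lifetimes I j)" "0 \<le> wt I j"
    if j: "j \<in> {1..nclasses I}" for j
    using instance_class[OF I j] p[OF j] remaining_start[of _ "cnt I j" "aug I j"]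
    by (auto simp: lifetimes_def start_lifetimes_def)
  ultimately show ?thesis unfolding consistent_def placed_def by auto
qed

text \<open>Every offline server starts on a point where the same class of the algorithm has a
  server with its full lifetime ahead, so nothing is owed. Hence the competitive bound has no
  additive term.\<close>

lemma potential_start:
  assumes I: "wks_instance I" and p: "\<And>j. j \<in> {1..nclasses I} \<Longrightarrow> p j = Suc (cnt I j)"
    and y: "\<forall>j\<in>{1..nclasses I}. \<forall>i\<in>{1..cnt I j}. y j i = start I j i"
  shows "potential I (start_config I) p (\<lambda>_ _. 0) (start_lifetimes I) y = 0"
proof -
  have "debt I (start_config I) p (\<lambda>_ _. 0) (start_lifetimes I) j v = 0"
    if j: "j \<in> {1..nclasses I}" and v: "v \<in> y j ` {1..cnt I j}" for j v
  proof -
    obtain i where i: "i \<in> {1..cnt I j}" "v = start I j i" using v y j by auto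
    note cl = instance_class[OF I j]
    have "remaining (aug I j) (p j) i = start_lifetimes I j i"
      using cl p[OF j] i remaining_start[of i "cnt I j" "aug I j"] by (simp add: start_lifetimes_def)
    moreover have "0 < start_lifetimes I j i" using i by (simp add: start_lifetimes_def)
    ultimately have "wt I j \<le> safety (wt I j) (aug I j) (p j) (start_lifetimes I j) (start_config I j) (\<lambda>_. 0) v"
      using safety_ge_slot[of i "aug I j" "start_config I j" v "wt I j" "p j" "start_lifetimes I j" "\<lambda>_. 0"]
        i cl start_config_start[OF j i(1)] by simp
    then show ?thesis
      using debt_bounds(1)[OF I consistent_start[where p = p, OF I p] j, of v] by (simp add: debt_def)
  qed
  then show ?thesis by (simp add: potential_def)
qed

text \<open>Server \<open>(1, 1)\<close> visits all requests while the others stay. This makes the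
  set of costs in \<open>opt\<close> nonempty, as needed for bounding its infimum from
  below.\<close>

lemma schedule_exists:
  assumes I: "wks_instance I" and "set \<sigma> \<subseteq> points I"
  shows "\<exists>cs. schedule I (cnt I) \<sigma> cs"
proof -
  define d where "d r = (start I)(1 := (start I 1)(1 := r))" for r
  have "1 \<in> {1..nclasses I}" "1 \<in> {1..cnt I 1}"
    using I unfolding wks_instance_def by auto
  then have "covers I (cnt I) r (d r)" for r
    unfolding covers_def d_def by (intro bexI[of _ 1]) auto
  moreover have pl: "placed I (cnt I) (start I)"
    using I unfolding wks_instance_def placed_def by blast
  then have "placed I (cnt I) (d r)" if "r \<in> points I" for r
    using that unfolding placed_def d_def by auto
  ultimately have "list_all2 (\<lambda>r c. placed I (cnt I) c \<and> covers I (cnt I) r c) \<sigma> (map d \<sigma>)"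
    using assms(2) by (induction \<sigma>) auto
  with pl show ?thesis unfolding schedule_def by blast
qed

lemma le_opt:
  assumes "wks_instance I" "set \<sigma> \<subseteq> points I" "0 < q"
    and "\<And>cs. schedule I (cnt I) \<sigma> cs \<Longrightarrow> z \<le> q * cost I (cnt I) cs"
  shows "z \<le> q * opt I \<sigma>"
proof -
  have "z / q \<le> opt I \<sigma>"
    unfolding opt_def using schedule_exists[OF assms(1,2)] assms(3,4)
    by (intro cInf_greatest) (auto simp: divide_le_eq mult.commute)
  then show ?thesis using assms(3) by (simp add: divide_le_eq mult.commute)
qed

section \<open>Growth of the competitive factor and of the running time\<close>

lemma linear_in_bigo: "(\<lambda>l. 4 * real l) \<in> O(\<lambda>l. real l ^ 2 * ln (real l))"
proof (rule bigoI[where c = 4])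
  \<comment> \<open>The threshold 3 exceeds \<open>exp 1\<close>, so the logarithm is at least 1
    from there on; at \<open>l = 1\<close> it would be 0.\<close>
  have "norm (4 * real l) \<le> 4 * norm (real l ^ 2 * ln (real l))" if "3 \<le> l" for l :: nat
  proof -
    have "exp 1 \<le> real l" using exp_le that by linarith
    then have "1 \<le> ln (real l)" using that by (subst ln_ge_iff) auto
    then have "real l * 1 \<le> real l ^ 2 * ln (real l)"
      using that by (intro mult_mono) (auto simp: power2_eq_square)
    then show ?thesis by simp
  qed
  then show "eventually (\<lambda>l. norm (4 * real l) \<le> 4 * norm (real l ^ 2 * ln (real l))) at_top"
    unfolding eventually_at_top_linorder by blast
qed

lemma instance_size:
  assumes I: "wks_instance I"
  shows "1 \<le> inst_size I" "nclasses I \<le> inst_size I"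
    "j \<in> {1..nclasses I} \<Longrightarrow> aug I j \<le> 2 * inst_size I ^ 2"
proof -
  have "(\<Sum>j = 1..nclasses I. 1) \<le> (\<Sum>j = 1..nclasses I. cnt I j)"
    using I unfolding wks_instance_def by (intro sum_mono) auto
  then show l: "nclasses I \<le> inst_size I" unfolding inst_size_def by simp
  show "1 \<le> inst_size I" using I unfolding wks_instance_def inst_size_def by auto
  assume "j \<in> {1..nclasses I}"
  then have "cnt I j \<le> (\<Sum>j = 1..nclasses I. cnt I j)" by (intro member_le_sum) auto
  then have "cnt I j \<le> inst_size I" unfolding inst_size_def by simp
  with l show "aug I j \<le> 2 * inst_size I ^ 2"
    unfolding aug_def by (simp add: power2_eq_square mult_le_mono)
qed

lemma time_bounds:
  fixes N l t :: nat
  assumes "1 \<le> N" "l \<le> N"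
  shows "l * (l * 5 + 2 * N ^ 2 * 5 + 22) + 3 \<le> 100 * (N + t) ^ 3"
    and "l * (2 * N ^ 2 * 6 + 18) + 40 \<le> 100 * (N + t) ^ 3"
proof -
  have sq: "N \<le> N ^ 2" "1 \<le> N ^ 2" "1 \<le> N ^ 3" using assms(1) by (auto simp: power2_eq_square)
  have cube: "N * N ^ 2 = N ^ 3" by (simp add: power2_eq_square power3_eq_cube)
  have "N ^ 3 \<le> (N + t) ^ 3" by (intro power_mono) auto
  \<comment> \<open>As \<open>l\<close> and 1 are at most \<open>N ^ 2\<close>, the coefficients add
    up to \<open>5 + 10 + 22\<close>; in the next bound they add up to
    \<open>12 + 18\<close>.\<close>
  moreover have "l * (l * 5 + 2 * N ^ 2 * 5 + 22) \<le> N * (N ^ 2 * 37)"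
    using assms sq by (intro mult_le_mono) linarith+
  moreover have "l * (2 * N ^ 2 * 6 + 18) \<le> N * (N ^ 2 * 30)"
    using assms sq by (intro mult_le_mono) linarith+
  ultimately show "l * (l * 5 + 2 * N ^ 2 * 5 + 22) + 3 \<le> 100 * (N + t) ^ 3"
    "l * (2 * N ^ 2 * 6 + 18) + 40 \<le> 100 * (N + t) ^ 3"
    using sq unfolding mult.assoc[symmetric, of N] cube by linarith+
qed

lemma play_competitive:
  assumes I: "wks_instance I" and \<sigma>: "set \<sigma> \<subseteq> points I"
    and B: "B = (\<lambda>t. 100 * (inst_size I + t) ^ 3)"
  shows "\<exists>ms. play (init_prog, serve_prog) B I \<sigma> = return_pmf ms \<and> all_halted ms \<and>
    schedule I (aug I) \<sigma> (map config_of ms) \<and>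
    cost I (aug I) (map config_of ms) \<le> 4 * real (nclasses I) * opt I \<sigma>"
proof -
  let ?A = "2 * inst_size I ^ 2"
  have A: "aug I j \<le> ?A" if "j \<in> {1..nclasses I}" for j using instance_size(3)[OF I that] .
  note bounds = time_bounds[OF instance_size(1,2)[OF I]]
  have B0: "nclasses I * (nclasses I * 5 + ?A * 5 + 22) + 3 \<le> B 0"
    and B1: "nclasses I * (?A * 6 + 18) + 40 \<le> B t" for t
    unfolding B using bounds by blast+
  obtain s where s: "steps (B 0) (init_prog, load I) = return_pmf (SKIP, s)" "ready I s"
    "nats s ''pos'' = start_config I" "reals s ''c'' = (\<lambda>_ _. 0)"
    "\<And>j. j \<in> {1..nclasses I} \<Longrightarrow> nats s ''p'' j 0 = Suc (cnt I j)"
    by (rule steps_if_runs[OF runs_init_prog[where A = ?A, OF I A] B0]) blast+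
  have con: "consistent I (nats s ''pos'') (\<lambda>j. nats s ''p'' j 0) (reals s ''c'') (start_lifetimes I)"
    unfolding s(3,4) using s(5) by (rule consistent_start[OF I])
  obtain ms where ms: "serve serve_prog B \<sigma> 1 s = return_pmf ms" "all_halted ms"
      "list_all2 (\<lambda>r c. placed I (aug I) c \<and> covers I (aug I) r c) \<sigma> (map config_of ms)"
    and le: "\<And>y ds. list_all2 (covers I (cnt I)) \<sigma> ds \<Longrightarrow>
         cost I (aug I) (start_config I # map config_of ms) \<le>
         potential I (start_config I) (\<lambda>j. nats s ''p'' j 0) (\<lambda>_ _. 0) (start_lifetimes I) y
           + 4 * real (nclasses I) * cost I (cnt I) (y # ds)"
    using serve_competitive[where A = ?A and B = B, OF I A B1 s(2) con \<sigma> order_refl] unfolding s(3,4) by blast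
  have "play (init_prog, serve_prog) B I \<sigma> = return_pmf ((SKIP, s) # ms)"
    by (simp add: play_def s(1) ms(1)[simplified] bind_return_pmf)
  moreover have "all_halted ((SKIP, s) # ms)" using ms(2) by (simp add: all_halted_def)
  moreover have conf: "map config_of ((SKIP, s) # ms) = start_config I # map config_of ms"
    by (simp add: config_of_def s(3))
  moreover have "schedule I (aug I) \<sigma> (start_config I # map config_of ms)"
    using con ms(3) start_config_start unfolding schedule_def consistent_def s(3) by blast
  moreover have "cost I (aug I) (start_config I # map config_of ms) \<le> 4 * real (nclasses I) * opt I \<sigma>"
  proof (rule le_opt[OF I \<sigma>])
    show "0 < 4 * real (nclasses I)" using I unfolding wks_instance_def by auto
    fix cs assume "schedule I (cnt I) \<sigma> cs"
    then obtain y ds where cs: "cs = y # ds"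
      and y: "\<forall>j\<in>{1..nclasses I}. \<forall>i\<in>{1..cnt I j}. y j i = start I j i"
      and "list_all2 (\<lambda>r c. placed I (cnt I) c \<and> covers I (cnt I) r c) \<sigma> ds"
      unfolding schedule_def by blast
    then have "list_all2 (covers I (cnt I)) \<sigma> ds" by (auto elim: list_all2_mono)
    \<comment> \<open>The schedule starts at the given positions, so the initial potential
      vanishes.\<close>
    from le[OF this, of y] potential_start[where p = "\<lambda>j. nats s ''p'' j 0", OF I s(5) y]
    show "cost I (aug I) (start_config I # map config_of ms) \<le> 4 * real (nclasses I) * cost I (cnt I) cs"
      unfolding cs by simp
  qed
  ultimately show ?thesis by metis
qed

theorem theorem1p4:
  shows "\<exists>(A :: online_alg) (p :: nat poly) (f :: nat \<Rightarrow> real).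
    f \<in> O(\<lambda>l. real l ^ 2 * ln (real l)) \<and>
    (\<forall>(I :: wks) (\<sigma> :: nat list).
       wks_instance I \<longrightarrow> set \<sigma> \<subseteq> points I \<longrightarrow>
       (let \<kappa> = (\<lambda>j. 2 * nclasses I * cnt I j);
            B = (\<lambda>t. poly p (inst_size I + t))
        in (\<forall>ms \<in> set_pmf (play A B I \<sigma>).
              all_halted ms \<and> schedule I \<kappa> \<sigma> (map config_of ms)) \<and>
           expected_cost A B I \<kappa> \<sigma> \<le> f (nclasses I) * opt I \<sigma>))"
proof (rule exI[of _ "(init_prog, serve_prog)"], rule exI[of _ "monom 100 3"],
    rule exI[of _ "\<lambda>l. 4 * real l"], intro conjI allI impI)
  fix I :: wks and \<sigma> :: "nat list"
  assume I: "wks_instance I" "set \<sigma> \<subseteq> points I"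
  let ?B = "\<lambda>t. 100 * (inst_size I + t) ^ 3"
  have \<kappa>: "(\<lambda>j. 2 * nclasses I * cnt I j) = aug I" by (simp add: aug_def fun_eq_iff)
  have B: "(\<lambda>t. poly (monom 100 3) (inst_size I + t)) = ?B" by (simp add: poly_monom)
  \<comment> \<open>The play is a point mass, so both its support and the expected cost are
    determined by this single outcome.\<close>
  obtain ms where "play (init_prog, serve_prog) ?B I \<sigma> = return_pmf ms" "all_halted ms"
    "schedule I (aug I) \<sigma> (map config_of ms)"
    "cost I (aug I) (map config_of ms) \<le> 4 * real (nclasses I) * opt I \<sigma>"
    using play_competitive[OF I, of ?B] by blast
  then show "let \<kappa> = (\<lambda>j. 2 * nclasses I * cnt I j);
            B = (\<lambda>t. poly (monom 100 3) (inst_size I + t))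
        in (\<forall>ms \<in> set_pmf (play (init_prog, serve_prog) B I \<sigma>).
              all_halted ms \<and> schedule I \<kappa> \<sigma> (map config_of ms)) \<and>
           expected_cost (init_prog, serve_prog) B I \<kappa> \<sigma> \<le> 4 * real (nclasses I) * opt I \<sigma>"
    unfolding \<kappa> B Let_def expected_cost_def by simp
qed (rule linear_in_bigo)

end
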